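(* Let $N=2g+1$ be odd, let $\alpha_1,\dots,\alpha_N\in\mathbb{C}$ be distinct, and let $R(\lambda)$ be an $\alpha$-admissible polynomial with distinct roots. Let $\Gamma_R$ be the hyperelliptic curve $\mu^2=R(\lambda)$, let $M_R^\alpha$ be the affine variety of $\alpha$-triples $(A,B,C)$ with discriminant $B^2-AC=R$, and let $P_R^\alpha\subset M_R^\alpha$ be its subvariety given by the additional condition $C(\alpha_N)=0$ (the pure periodic case). There exists a bijection between the set $M_R^\alpha$ and the extended affine Jacobi variety $J(\Gamma_R)^{aff}\times\mathbb{C}$. The corresponding algebraic functions $\phi=\frac{-B+\sqrt{R}}{A}$ can be characterised as meromorphic functions $\phi\in L(D+P_\infty)$ on $\Gamma_R$ with non-special pole divisor $D+P_\infty$ and asymptotic $\phi\sim\sqrt{\lambda}$ at infinity. In the pure periodic case, under the assumption that $R(\alpha_N)\ne0$, there exists a natural $2:1$ map from the set $P_R^\alpha$ to $J(\Gamma_R)^{aff}$. The corresponding $\phi$ from $L(D+P_\infty)$ are fixed by the condition that one of the two values of $\phi(\alpha_N)$ is zero.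
   Context: A polynomial $R$ of degree $N=2g+1$ is $\alpha$-admissible if $R=S^2+\prod_{i=1}^N(\lambda-\alpha_i)$ for some polynomial $S$ of degree at most $g$. An $\alpha$-triple is a triple $(A,B,C)$ of polynomials in $\mathbb{C}[\lambda]$ such that $\deg B\le g$, $A$ is monic of degree $g$, $C$ has degree $g+1$ and highest coefficient $-1$, and the discriminant $B^2-AC$ is $\alpha$-admissible. The curve $\Gamma_R$ is non-singular of genus $g$ and consists of the affine part $\Gamma_R^{aff}=\{(\lambda,\mu)\in\mathbb{C}^2:\mu^2=R(\lambda)\}$ and one point $P_\infty$ at infinity. The function $\phi=\frac{-B+\sqrt R}{A}$ is viewed as the function $\frac{-B(\lambda)+\mu}{A(\lambda)}$ on $\Gamma_R$; the two values of $\phi(\alpha_N)$ are its values at the two points of $\Gamma_R$ with $\lambda=\alpha_N$. The hyperelliptic involution is $\tau(\lambda,\mu)=(\lambda,-\mu)$. A divisor $D=P_1+\dots+P_g$ with $P_i\in\Gamma_R^{aff}$ (not necessarily distinct) is called non-special if $P_i\ne\tau(P_j)$ for all $i\ne j$. The affine Jacobi variety $J(\Gamma_R)^{aff}$ is the set of all such positive non-special divisors $D=P_1+\dots+P_g$. "Non-special pole divisor $D+P_\infty$" means that $D$ is non-special in this sense. $L(D+P_\infty)$ is the linear space of meromorphic functions $f$ on $\Gamma_R$ with poles at most $D+P_\infty$, i.e. $f=0$ or $(f)+D+P_\infty\ge0$. The branch of $\sqrt\lambda$ near $P_\infty$ is the one with $\mu\sim\lambda^g\sqrt\lambda$.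
   Formalization: The 2:1 map is stated with exact fibres: two preimages over D unless D contains a point with λ=α_N, in which case there is exactly one (A(α_N)=0 makes the condition C(α_N)=0 linear), so a literal 2:1 map fails over such D. *)

theory Defs
  imports
    "HOL-Complex_Analysis.Complex_Analysis"
    "HOL-Computational_Algebra.Polynomial"
    "HOL-Library.Multiset"
    "HOL-Library.Landau_Symbols"
begin

definition alpha_admissible :: "nat \<Rightarrow> (nat \<Rightarrow> complex) \<Rightarrow> complex poly \<Rightarrow> bool" where
  "alpha_admissible g \<alpha> R \<longleftrightarrow> degree R = 2 * g + 1 \<and>
     (\<exists>S. degree S \<le> g \<and> R = S\<^sup>2 + (\<Prod>i\<in>{1..2 * g + 1}. [:- \<alpha> i, 1:]))"

type_synonym triple = "complex poly \<times> complex poly \<times> complex poly"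

definition alpha_triple :: "nat \<Rightarrow> (nat \<Rightarrow> complex) \<Rightarrow> triple \<Rightarrow> bool" where
  "alpha_triple g \<alpha> = (\<lambda>(A, B, C).
     degree B \<le> g \<and> degree A = g \<and> lead_coeff A = 1 \<and>
     degree C = g + 1 \<and> lead_coeff C = -1 \<and> alpha_admissible g \<alpha> (B\<^sup>2 - A * C))"

definition triples_with_discr :: "nat \<Rightarrow> (nat \<Rightarrow> complex) \<Rightarrow> complex poly \<Rightarrow> triple set" where
  "triples_with_discr g \<alpha> R = {(A, B, C). alpha_triple g \<alpha> (A, B, C) \<and> B\<^sup>2 - A * C = R}"

definition pure_periodic_triples :: "nat \<Rightarrow> (nat \<Rightarrow> complex) \<Rightarrow> complex poly \<Rightarrow> triple set" where
  "pure_periodic_triples g \<alpha> R =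
     {(A, B, C). (A, B, C) \<in> triples_with_discr g \<alpha> R \<and> poly C (\<alpha> (2 * g + 1)) = 0}"

datatype cpoint = Aff complex complex | Infty

definition affine_curve :: "complex poly \<Rightarrow> cpoint set" where
  "affine_curve R = {Aff x y | x y. y\<^sup>2 = poly R x}"

definition curve :: "complex poly \<Rightarrow> cpoint set" where
  "curve R = insert Infty (affine_curve R)"

fun hyp_inv :: "cpoint \<Rightarrow> cpoint" where
  "hyp_inv (Aff x y) = Aff x (- y)"
| "hyp_inv Infty = Infty"

text \<open>
  The complex structure of the curve \<open>y\<^sup>2 = R(x)\<close>, for \<open>R\<close> monic of odd degree with distinct
  roots: \<open>chart R P\<close> is a local parametrisation sending \<open>0\<close> to \<open>P\<close>; only its germ at \<open>0\<close> matters.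
  The arguments of \<open>csqrt\<close> that depend on \<open>t\<close> equal \<open>1\<close> at \<open>t = 0\<close>, so that \<open>csqrt\<close> is holomorphic
  there. The parameter is \<open>x - a\<close> at an ordinary point, a square root of \<open>x - a\<close> at a branch point,
  and at infinity \<open>x = 1 / t\<^sup>2\<close>, where \<open>poly (reflect_poly R) (t\<^sup>2) = t ^ (2 * degree R) * R (1 / t\<^sup>2)\<close>.
  The sign of \<open>y\<close> in the chart at infinity is such that \<open>y\<close> is asymptotic to \<open>x ^ g * (1 / t)\<close> for
  \<open>degree R = 2 * g + 1\<close>; the branch of \<open>sqrt x\<close> with \<open>y \<sim> x ^ g * sqrt x\<close> is thus \<open>1 / t\<close>.
\<close>
definition chart :: "complex poly \<Rightarrow> cpoint \<Rightarrow> complex \<Rightarrow> cpoint" where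
  "chart R P t = (case P of
     Infty \<Rightarrow> if t = 0 then Infty
              else Aff (1 / t\<^sup>2) (csqrt (poly (reflect_poly R) (t\<^sup>2)) / t ^ degree R)
   | Aff a b \<Rightarrow>
       if b \<noteq> 0 then Aff (a + t) (b * csqrt (poly R (a + t) / b\<^sup>2))
       else let Q = R div [:- a, 1:] in
         Aff (a + t\<^sup>2) (t * csqrt (poly Q a) * csqrt (poly Q (a + t\<^sup>2) / poly Q a)))"

text \<open>
  As for \<open>meromorphic_on\<close>, the values of a meromorphic function at isolated points (in particular at
  its poles and at \<open>Infty\<close>) are irrelevant, so equality of meromorphic functions is \<open>mero_eq\<close>, and
  the value at a point is the limit there.
\<close>
definition mero_curve :: "complex poly \<Rightarrow> (cpoint \<Rightarrow> complex) \<Rightarrow> bool" where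
  "mero_curve R f \<longleftrightarrow> (\<forall>P\<in>curve R. (\<lambda>t. f (chart R P t)) meromorphic_on {0})"

definition mero_eq :: "complex poly \<Rightarrow> (cpoint \<Rightarrow> complex) \<Rightarrow> (cpoint \<Rightarrow> complex) \<Rightarrow> bool" where
  "mero_eq R f h \<longleftrightarrow> (\<forall>P\<in>curve R. \<forall>\<^sub>F t in at 0. f (chart R P t) = h (chart R P t))"

definition vanishes_at :: "complex poly \<Rightarrow> (cpoint \<Rightarrow> complex) \<Rightarrow> cpoint \<Rightarrow> bool" where
  "vanishes_at R f P \<longleftrightarrow> ((\<lambda>t. f (chart R P t)) \<longlongrightarrow> 0) (at 0)"

text \<open>The order is meaningful only for meromorphic functions that are not identically zero.\<close>
definition ord_at :: "complex poly \<Rightarrow> (cpoint \<Rightarrow> complex) \<Rightarrow> cpoint \<Rightarrow> int" where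
  "ord_at R f P = zorder (\<lambda>t. f (chart R P t)) 0"

text \<open>Positive divisors are multisets of points.\<close>
definition L_space :: "complex poly \<Rightarrow> cpoint multiset \<Rightarrow> (cpoint \<Rightarrow> complex) set" where
  "L_space R E = {f. mero_curve R f \<and>
     (mero_eq R f (\<lambda>_. 0) \<or> (\<forall>P\<in>curve R. ord_at R f P + int (count E P) \<ge> 0))}"

definition has_pole_divisor :: "complex poly \<Rightarrow> (cpoint \<Rightarrow> complex) \<Rightarrow> cpoint multiset \<Rightarrow> bool" where
  "has_pole_divisor R f E \<longleftrightarrow> mero_curve R f \<and> \<not> mero_eq R f (\<lambda>_. 0) \<and> set_mset E \<subseteq> curve R \<and>
     (\<forall>P\<in>curve R. int (count E P) = max 0 (- ord_at R f P))"

text \<open>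
  For \<open>D = P\<^sub>1 + \<dots> + P\<^sub>g\<close> this says \<open>P\<^sub>i \<noteq> hyp_inv P\<^sub>j\<close> for all indices \<open>i \<noteq> j\<close>; a branch point
  can thus occur at most once.
\<close>
definition non_special :: "cpoint multiset \<Rightarrow> bool" where
  "non_special D \<longleftrightarrow> (\<forall>P\<in>#D. hyp_inv P \<notin># D - {#P#})"

definition affine_jacobi :: "nat \<Rightarrow> complex poly \<Rightarrow> cpoint multiset set" where
  "affine_jacobi g R = {D. size D = g \<and> set_mset D \<subseteq> affine_curve R \<and> non_special D}"

fun phi :: "triple \<Rightarrow> cpoint \<Rightarrow> complex" where
  "phi (A, B, C) (Aff x y) = (- poly B x + y) / poly A x"
| "phi (A, B, C) Infty = 0"

definition asymp_sqrt :: "complex poly \<Rightarrow> (cpoint \<Rightarrow> complex) \<Rightarrow> bool" where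
  "asymp_sqrt R f \<longleftrightarrow> asymp_equiv (\<lambda>t. f (chart R Infty t)) (at 0) (\<lambda>t. 1 / t)"

end

theory Submission
  imports Defs "HOL-Computational_Algebra.Fundamental_Theorem_Algebra"
begin

text \<open>
  A triple is determined by \<open>(A, B)\<close> with \<open>A\<close> dividing \<open>B\<^sup>2 - R\<close>, which is Mumford's description of
  divisors: the pole divisor of \<open>phi\<close> consists of the points \<open>(a, - B(a))\<close> over the roots \<open>a\<close> of
  \<open>A\<close>. It determines \<open>A\<close> and \<open>B\<close> modulo \<open>A\<close>, hence leaves one free parameter, the coefficient of
  \<open>x ^ g\<close> in \<open>B\<close>, which is minus the constant term of \<open>phi - 1 / t\<close> at infinity.
  Along the family \<open>B + \<beta> A\<close> the value of \<open>C\<close> at a point is a polynomial in \<open>\<beta>\<close> of degree at most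
  \<open>2\<close> and discriminant \<open>4 R\<close>.

  Conversely, let \<open>f\<close> have poles bounded by such a divisor plus the point at infinity, and
  \<open>f \<sim> 1 / t\<close> there. The part of \<open>A f\<close> that is invariant under the hyperelliptic involution and the
  quotient of the anti-invariant part by \<open>y\<close> are functions of \<open>x\<close> which extend to entire functions.
  By Liouville's theorem the first is a polynomial of degree at most \<open>g\<close> and the second is \<open>1\<close>, so
  \<open>f = (- B' + y) / A\<close>; that \<open>f\<close> is regular at the conjugates of its poles forces
  \<open>B' \<equiv> B (mod A)\<close>.
\<close>

subsection \<open>Triples and divisors\<close>

text \<open>Over a root \<open>a\<close> of \<open>A\<close> the points of the curve have
  \<open>y = B(a)\<close> or \<open>y = - B(a)\<close>. The numerator \<open>- B + y\<close> of
  \<open>phi\<close> vanishes at the first and equals \<open>- 2 B(a)\<close> at the second; hence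
  the sign.\<close>

definition triple_divisor :: "triple \<Rightarrow> cpoint multiset" where
  "triple_divisor = (\<lambda>(A, B, C). image_mset (\<lambda>a. Aff a (- poly B a)) (proots A))"

lemma triple_divisor_simp:
  "triple_divisor (A, B, C) = image_mset (\<lambda>a. Aff a (- poly B a)) (proots A)"
  by (simp add: triple_divisor_def)

lemma count_triple_divisor:
  assumes "A \<noteq> 0"
  shows "count (triple_divisor (A, B, C)) (Aff a b) = (if b = - poly B a then order a A else 0)"
proof -
  have "count (image_mset (\<lambda>a. Aff a (- poly B a)) M) (Aff a b) =
      (if b = - poly B a then count M a else 0)" for M
    by (induction M) auto
  with assms show ?thesis
    by (simp add: triple_divisor_simp)
qed

lemma Infty_notin_triple_divisor: "Infty \<notin># triple_divisor (A, B, C)"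
  by (auto simp: triple_divisor_simp)

section \<open>Normalisation of \<open>R\<close> and of the triples\<close>

text \<open>\<open>S\<^sup>2\<close> has degree at most \<open>2 * g\<close>, so the leading term
  comes from the product of the linear factors.\<close>

lemma alpha_admissible_monic:
  assumes "alpha_admissible g \<alpha> R"
  shows "degree R = 2 * g + 1" "lead_coeff R = 1"
proof -
  let ?P = "\<Prod>i\<in>{1..2 * g + 1}. [:- \<alpha> i, 1:]"
  from assms obtain S where S: "degree R = 2 * g + 1" "degree S \<le> g" "R = S\<^sup>2 + ?P"
    by (auto simp: alpha_admissible_def)
  show "degree R = 2 * g + 1" by fact
  have P: "degree ?P = 2 * g + 1" "lead_coeff ?P = 1"
    by (subst degree_prod_eq_sum_degree; simp) (simp add: lead_coeff_prod del: prod.cl_ivl_Suc)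
  have "degree (S\<^sup>2) < 2 * g + 1"
    using S(2) degree_power_le[of S 2] by linarith
  then have "coeff (S\<^sup>2) (2 * g + 1) = 0"
    by (rule coeff_eq_0)
  with P S(1,3) show "lead_coeff R = 1"
    by (metis add_0 coeff_add)
qed

lemma degree_square_diff:
  fixes B R :: "complex poly"
  assumes "degree R = 2 * g + 1" "lead_coeff R = 1" "degree B \<le> g"
  shows "degree (B\<^sup>2 - R) = 2 * g + 1" "lead_coeff (B\<^sup>2 - R) = -1"
proof -
  have "degree (B\<^sup>2) < degree R"
    using assms degree_power_le[of B 2] by linarith
  then show "degree (B\<^sup>2 - R) = 2 * g + 1" "lead_coeff (B\<^sup>2 - R) = -1"
    using assms degree_add_eq_right[of "B\<^sup>2" "- R"] lead_coeff_add_le[of "B\<^sup>2" "- R"] by auto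
qed

text \<open>In \<open>A * C = B\<^sup>2 - R\<close> the right side has the leading term of
  \<open>- R\<close>; comparing degrees and leading coefficients recovers the normalisation of
  \<open>C\<close>.\<close>

lemma triples_with_discr_iff:
  assumes "alpha_admissible g \<alpha> R"
  shows "(A, B, C) \<in> triples_with_discr g \<alpha> R \<longleftrightarrow>
    degree B \<le> g \<and> degree A = g \<and> lead_coeff A = 1 \<and> B\<^sup>2 - A * C = R" (is "?l \<longleftrightarrow> ?r")
proof
  assume ?l
  then show ?r by (auto simp: triples_with_discr_def alpha_triple_def)
next
  assume r: ?r
  note R = alpha_admissible_monic[OF assms]
  have AC: "A * C = B\<^sup>2 - R" using r by (simp add: algebra_simps)
  note d = degree_square_diff[OF R, of B]
  have deg: "degree (A * C) = 2 * g + 1" and lc: "lead_coeff (A * C) = -1"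
    using d r unfolding AC by auto
  have "A \<noteq> 0" "C \<noteq> 0" using deg by auto
  then have "degree C = g + 1" using deg r by (simp add: degree_mult_eq)
  moreover have "lead_coeff C = -1" using lc r by (auto simp: lead_coeff_mult)
  ultimately show ?l
    using r assms by (auto simp: triples_with_discr_def alpha_triple_def)
qed

text \<open>The points of the divisor lie on the graph of \<open>- B\<close>, so a point and its
  conjugate both occur only if \<open>B(a) = 0\<close>, that is, at a branch point. Occurring twice
  there makes \<open>a\<close> a double root of \<open>A\<close> and of \<open>B\<^sup>2\<close>,
  hence of \<open>R\<close>, against squarefreeness.\<close>

lemma triple_divisor_in_affine_jacobi:
  assumes "alpha_admissible g \<alpha> R" "rsquarefree R" "T \<in> triples_with_discr g \<alpha> R"
  shows "triple_divisor T \<in> affine_jacobi g R"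
proof -
  obtain A B C where T: "T = (A, B, C)" by (cases T)
  have r: "degree A = g" "lead_coeff A = 1" "B\<^sup>2 - A * C = R"
    using assms T triples_with_discr_iff by auto
  then have A0: "A \<noteq> 0" by auto
  have "size (triple_divisor T) = g"
    using r by (simp add: T triple_divisor_simp size_proots_complex)
  moreover have "set_mset (triple_divisor T) \<subseteq> affine_curve R"
    using A0 r(3) by (auto simp: T triple_divisor_simp affine_curve_def)
  moreover have "non_special (triple_divisor T)"
    unfolding non_special_def
  proof
    fix P assume P: "P \<in># triple_divisor T"
    then obtain a where a: "P = Aff a (- poly B a)" "poly A a = 0"
      using A0 by (auto simp: T triple_divisor_simp)
    show "hyp_inv P \<notin># triple_divisor T - {#P#}"
    proof
      assume *: "hyp_inv P \<in># triple_divisor T - {#P#}"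
      then have "hyp_inv P \<in># triple_divisor T" by (rule in_diffD)
      then have B0: "poly B a = 0"
        using a by (auto simp: T triple_divisor_simp)
      then have "P \<in># triple_divisor T - {#P#}" using * a by simp
      then have "0 < count (triple_divisor T - {#P#}) P"
        by (simp only: count_greater_zero_iff)
      then have "count (triple_divisor T) P \<ge> 2"
        unfolding count_diff by simp
      then have "order a A \<ge> 2"
        using B0 a by (simp add: T count_triple_divisor[OF A0])
      then have "[:-a, 1:]\<^sup>2 dvd A" by (simp add: order_divides)
      moreover have "[:-a, 1:]\<^sup>2 dvd B\<^sup>2"
        using B0 by (intro dvd_power_same) (simp add: poly_eq_0_iff_dvd)
      ultimately have "[:-a, 1:]\<^sup>2 dvd R"
        using r(3) by (metis dvd_diff dvd_mult2)
      then show False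
        using assms(2) by (auto simp: order_divides rsquarefree_def dest!: spec[of _ a])
    qed
  qed
  ultimately show ?thesis by (simp add: affine_jacobi_def)
qed

section \<open>Recovering a triple from its divisor and one coefficient\<close>

text \<open>Complex polynomials split, so divisibility amounts to an inclusion of the multisets of
  roots.\<close>

lemma dvd_if_order_le:
  fixes p q :: "complex poly"
  assumes "p \<noteq> 0" "\<And>a. poly p a = 0 \<Longrightarrow> [:-a, 1:] ^ order a p dvd q"
  shows "p dvd q"
proof (cases "q = 0")
  case False
  have "order a p \<le> order a q" for a
    using assms False by (cases "poly p a = 0") (auto simp: order_divides order_0I)
  then have "proots p \<subseteq># proots q"
    using assms(1) False by (simp add: subseteq_mset_def)
  then have "prod_mset (image_mset (\<lambda>a. [:-a, 1:]) (proots p)) dvd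
      prod_mset (image_mset (\<lambda>a. [:-a, 1:]) (proots q))"
    by (intro prod_mset_subset_imp_dvd image_mset_subseteq_mono)
  then have "smult (lead_coeff p) (prod_mset (image_mset (\<lambda>a. [:-a, 1:]) (proots p))) dvd
      smult (lead_coeff q) (prod_mset (image_mset (\<lambda>a. [:-a, 1:]) (proots q)))"
    using assms(1) by (intro smult_dvd dvd_smult) simp_all
  then show ?thesis
    by (simp only: complex_poly_decompose_multiset)
qed auto

lemma affine_jacobi_count_branch:
  assumes "D \<in> affine_jacobi g R"
  shows "count D (Aff a 0) \<le> 1"
proof (rule ccontr)
  assume *: "\<not> ?thesis"
  then have "Aff a 0 \<in># D" "hyp_inv (Aff a 0) \<in># D - {#Aff a 0#}"
    by (auto simp: not_le simp flip: count_greater_zero_iff)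
  then show False
    using assms by (auto simp: affine_jacobi_def non_special_def)
qed

text \<open>The \<open>x\<close>-coordinates of the divisor give \<open>A\<close>, the points give
  the values of \<open>B\<close> at its roots. For multiple roots, subtracting the two discriminant
  identities gives \<open>A dvd (B + B') * (B - B')\<close>: where \<open>B(a)\<close> is nonzero
  the first factor is a unit at \<open>a\<close>, and where \<open>B(a) = 0\<close> the root of
  \<open>A\<close> is simple.\<close>

lemma triple_divisor_inj:
  assumes "alpha_admissible g \<alpha> R" "rsquarefree R"
    and T: "(A, B, C) \<in> triples_with_discr g \<alpha> R" "(A', B', C') \<in> triples_with_discr g \<alpha> R"
    and eq: "triple_divisor (A, B, C) = triple_divisor (A', B', C')" "coeff B g = coeff B' g"
  shows "(A, B, C) = (A', B', C')"
proof -
  have r: "degree B \<le> g" "degree A = g" "lead_coeff A = 1" "B\<^sup>2 - A * C = R"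
    and r': "degree B' \<le> g" "degree A' = g" "lead_coeff A' = 1" "B'\<^sup>2 - A' * C' = R"
    using assms triples_with_discr_iff by auto
  then have A0: "A \<noteq> 0" "A' \<noteq> 0" by auto
  have "image_mset (\<lambda>P. case P of Aff a b \<Rightarrow> a | Infty \<Rightarrow> 0) (triple_divisor (A, B, C)) = proots A" for A B C
    by (simp add: triple_divisor_simp multiset.map_comp comp_def)
  then have "proots A = proots A'" using eq(1) by metis
  then have AA: "A = A'"
    using r r' complex_poly_decompose_multiset by (metis smult_1_left)
  have "A dvd B - B'"
  proof (rule dvd_if_order_le[OF A0(1)])
    fix a assume a: "poly A a = 0"
    then have "order a A > 0" using A0 by (simp add: order_gt_0_iff)
    then have Ba: "poly B a = poly B' a"
      using eq(1) count_triple_divisor[OF A0(1), of B C a "- poly B a"]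
        count_triple_divisor[OF A0(2), of B' C' a "- poly B a"] by (auto split: if_splits)
    have "A dvd (B + B') * (B - B')"
    proof -
      have "(B + B') * (B - B') = A * (C - C')"
        using r(4) r'(4) AA by (simp add: algebra_simps power2_eq_square)
      then show ?thesis by simp
    qed
    then have d: "[:-a, 1:] ^ order a A dvd (B + B') * (B - B')"
      using order_1 dvd_trans by blast
    show "[:-a, 1:] ^ order a A dvd B - B'"
    proof (cases "poly B a = 0")
      case False
      have "B + B' \<noteq> 0" using False Ba by (metis mult_2 mult_eq_0_iff poly_0 poly_add zero_neq_numeral)
      moreover have "poly (B + B') a \<noteq> 0" using False Ba by simp
      then have "order a (B + B') = 0" by (rule order_0I)
      ultimately show ?thesis
        using d by (cases "B - B' = 0") (auto simp: order_divides order_mult)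
    next
      case True
      have "count (triple_divisor (A, B, C)) (Aff a 0) \<le> 1"
        by (rule affine_jacobi_count_branch[OF triple_divisor_in_affine_jacobi[OF assms(1,2) T(1)]])
      then have "order a A \<le> 1"
        using True by (simp add: count_triple_divisor[OF A0(1)])
      moreover have "[:-a, 1:] dvd B - B'"
        using Ba by (simp add: poly_eq_0_iff_dvd[symmetric])
      ultimately show ?thesis
        by (metis dvd_trans le_imp_power_dvd power_one_right)
    qed
  qed
  \<comment> \<open>Equal coefficients of x^g push the difference below the degree of
    \<open>A\<close>, so divisibility by \<open>A\<close> forces it to vanish.\<close>
  moreover have "degree (B - B') < g \<or> B - B' = 0"
  proof -
    have "degree (B - B') \<le> g" using r r' by (simp add: degree_diff_le)
    moreover have "coeff (B - B') g = 0" using eq by simp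
    ultimately show ?thesis
      by (metis leading_coeff_0_iff le_neq_implies_less)
  qed
  ultimately have "B = B'"
    using r(2) by (metis dvd_imp_degree_le eq_iff_diff_eq_0 not_less)
  moreover from this have "A * C = A * C'" using r(4) r'(4) AA by (simp add: algebra_simps)
  ultimately show ?thesis using AA A0 by simp
qed

text \<open>Expanding \<open>(B + \<beta> A)\<^sup>2 - R\<close> and dividing by \<open>A\<close>
  gives the third entry. Adding a multiple of \<open>A\<close> keeps the values of \<open>B\<close>
  at the roots of \<open>A\<close>, hence the divisor, and moves the coefficient of x^g by \<beta>
  because \<open>A\<close> is monic of degree \<open>g\<close>.\<close>

lemma triple_shift:
  assumes "alpha_admissible g \<alpha> R" "(A, B, C) \<in> triples_with_discr g \<alpha> R"
  defines "T \<equiv> \<lambda>\<beta>. (A, B + smult \<beta> A, C + smult (2 * \<beta>) B + smult (\<beta>\<^sup>2) A)"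
  shows "T \<beta> \<in> triples_with_discr g \<alpha> R" "triple_divisor (T \<beta>) = triple_divisor (A, B, C)"
    "coeff (fst (snd (T \<beta>))) g = coeff B g + \<beta>"
proof -
  have r: "degree B \<le> g" "degree A = g" "lead_coeff A = 1" "B\<^sup>2 - A * C = R"
    using assms triples_with_discr_iff by auto
  have "A \<noteq> 0" using r by auto
  have eq: "(B + smult \<beta> A)\<^sup>2 - A * (C + smult (2 * \<beta>) B + smult (\<beta>\<^sup>2) A) = R"
    unfolding r(4)[symmetric] by (simp add: poly_eq_poly_eq_iff[symmetric] fun_eq_iff power2_eq_square algebra_simps)
  show "T \<beta> \<in> triples_with_discr g \<alpha> R"
    unfolding T_def triples_with_discr_iff[OF assms(1)]
    using r eq by (auto intro!: degree_add_le degree_smult_le[THEN order.trans])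
  show "triple_divisor (T \<beta>) = triple_divisor (A, B, C)"
    unfolding T_def triple_divisor_simp using \<open>A \<noteq> 0\<close> by (intro image_mset_cong) simp
  show "coeff (fst (snd (T \<beta>))) g = coeff B g + \<beta>"
    using r by (simp add: T_def)
qed

section \<open>Constructing a triple from a divisor\<close>

text \<open>The first Mumford polynomial of the divisor; it becomes the \<open>A\<close> of the
  triple.\<close>

definition divisor_poly :: "cpoint multiset \<Rightarrow> complex poly" where
  "divisor_poly D = (\<Prod>P\<in>#D. case P of Aff a b \<Rightarrow> [:-a, 1:] | Infty \<Rightarrow> 1)"

lemma divisor_poly_add_Aff: "divisor_poly (add_mset (Aff a b) D) = [:-a, 1:] * divisor_poly D"
  by (simp add: divisor_poly_def)

lemma monic_divisor_poly: "lead_coeff (divisor_poly D) = 1"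
proof (induction D)
  case (add P D)
  then show ?case by (cases P) (simp_all add: divisor_poly_def lead_coeff_mult del: mult_pCons_left)
qed (simp add: divisor_poly_def)

lemma divisor_poly_nz [simp]: "divisor_poly D \<noteq> 0"
  using monic_divisor_poly[of D] by auto

lemma degree_divisor_poly: "Infty \<notin># D \<Longrightarrow> degree (divisor_poly D) = size D"
proof (induction D)
  case (add P D)
  then show ?case
    by (cases P) (auto simp: divisor_poly_add_Aff degree_mult_eq simp del: mult_pCons_left)
qed (simp add: divisor_poly_def)

lemma poly_divisor_poly_eq_0_iff: "poly (divisor_poly D) a = 0 \<longleftrightarrow> (\<exists>b. Aff a b \<in># D)"
proof (induction D)
  case (add P D)
  then show ?case
    by (cases P) (auto simp: divisor_poly_def)
qed (simp add: divisor_poly_def)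

lemma proots_divisor_poly:
  "Infty \<notin># D \<Longrightarrow>
    proots (divisor_poly D) = image_mset (\<lambda>P. case P of Aff a b \<Rightarrow> a | Infty \<Rightarrow> 0) D"
proof (induction D)
  case (add P D)
  then show ?case
    by (cases P) (auto simp: divisor_poly_add_Aff proots_mult simp del: mult_pCons_left)
qed (simp add: divisor_poly_def)

lemma triple_divisor_divisor_poly:
  assumes "Infty \<notin># D" "\<And>a b. Aff a b \<in># D \<Longrightarrow> b = - poly B a"
  shows "triple_divisor (divisor_poly D, B, C) = D"
proof -
  have "triple_divisor (divisor_poly D, B, C) =
      image_mset (\<lambda>P. Aff (case P of Aff a b \<Rightarrow> a | Infty \<Rightarrow> 0) (- poly B (case P of Aff a b \<Rightarrow> a | Infty \<Rightarrow> 0))) D"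
    by (simp add: triple_divisor_simp proots_divisor_poly assms multiset.map_comp comp_def)
  also have "\<dots> = image_mset (\<lambda>P. P) D"
    using assms by (intro image_mset_cong) (force split: cpoint.splits)
  finally show ?thesis by simp
qed

text \<open>Non-speciality passes to subdivisors, which permits induction over the points; the
  second fact says that a new point is never conjugate to an old one.\<close>

lemma non_special_add_mset:
  assumes "non_special (add_mset P D)"
  shows "non_special D" "hyp_inv P \<notin># D"
proof -
  have ns: "hyp_inv Q \<notin># add_mset P D - {#Q#}" if "Q \<in># add_mset P D" for Q
    using assms that by (auto simp: non_special_def)
  show "hyp_inv P \<notin># D" using ns[of P] by simp
  have "D - {#Q#} \<subseteq># add_mset P D - {#Q#}" for Q
    by (simp add: subseteq_mset_def)
  then show "non_special D"
    using ns unfolding non_special_def by (metis insert_iff mset_subset_eqD set_mset_add_mset_insert)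
qed

text \<open>Newton interpolation: a point over \<open>a\<close> is added to \<open>D\<close> by adding to \<open>B\<close> a multiple of
  the polynomial of \<open>D\<close>; if the point is already in \<open>D\<close> this is a step of Hensel lifting.\<close>
lemma ex_interpolating_poly:
  assumes "set_mset D \<subseteq> affine_curve R" "non_special D"
  shows "\<exists>B. divisor_poly D dvd B\<^sup>2 - R \<and> (\<forall>a b. Aff a b \<in># D \<longrightarrow> b = - poly B a)"
  using assms
proof (induction D)
  case empty
  then show ?case by (simp add: divisor_poly_def)
next
  case (add P D)
  let ?A = "divisor_poly D"
  obtain a b where P: "P = Aff a b" and ab: "b\<^sup>2 = poly R a"
    using add.prems by (auto simp: affine_curve_def)
  note ns = non_special_add_mset[OF add.prems(2)]
  obtain B Q where Q: "B\<^sup>2 - R = ?A * Q" and B: "\<And>a b. Aff a b \<in># D \<Longrightarrow> b = - poly B a"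
    using add ns by (auto elim!: dvdE)
  have on: "b'\<^sup>2 = poly R a'" if "Aff a' b' \<in># D" for a' b'
    using add.prems that by (auto simp: affine_curve_def)
  define E where "E c = B + smult c ?A" for c
  have E: "(E c)\<^sup>2 - R = ?A * (Q + smult (2 * c) B + smult (c\<^sup>2) ?A)" for c
    unfolding E_def using Q
    by (simp add: poly_eq_poly_eq_iff[symmetric] fun_eq_iff power2_eq_square algebra_simps)
  \<comment> \<open>The enlarged polynomial has the extra factor \<open>x - a\<close>, so
    \<open>c\<close> must make the cofactor of \<open>?A\<close> vanish at \<open>a\<close>, besides
    giving \<open>E c\<close> the value \<open>- b\<close> there.\<close>
  have "\<exists>c. poly (Q + smult (2 * c) B + smult (c\<^sup>2) ?A) a = 0 \<and> b = - poly (E c) a"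
  proof (cases "poly ?A a = 0")
    \<comment> \<open>As the conjugate point is excluded, the old point over \<open>a\<close> is the
      new one and is no branch point. At \<open>a\<close> the equation for \<open>c\<close> is then
      linear with coefficient \<open>2 B(a)\<close>, which is nonzero, and the value of
      \<open>E c\<close> does not depend on \<open>c\<close>.\<close>
    case True
    then obtain b' where b': "Aff a b' \<in># D"
      by (auto simp: poly_divisor_poly_eq_0_iff)
    have "b'\<^sup>2 = b\<^sup>2" using on[OF b'] ab by simp
    moreover have "b' \<noteq> - b" using ns(2) b' P by auto
    ultimately have "b' = b" "b \<noteq> 0" using power2_eq_iff by fastforce+
    then have "b = - poly B a" "poly B a \<noteq> 0" using B[OF b'] by auto
    then show ?thesis
      using True by (intro exI[of _ "- poly Q a / (2 * poly B a)"]) (simp add: E_def)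
  next
    case False
    \<comment> \<open>The value of \<open>E c\<close> at \<open>a\<close> is prescribed to be
      \<open>- b\<close>. Then \<open>(E c)\<^sup>2 - R\<close> vanishes at \<open>a\<close>, and
      since \<open>?A\<close> does not, the cofactor does.\<close>
    define c where "c = (- b - poly B a) / poly ?A a"
    have c: "poly (E c) a = - b" using False by (simp add: E_def c_def)
    then have "poly ((E c)\<^sup>2 - R) a = 0" using ab by simp
    then show ?thesis using c False unfolding E by (intro exI[of _ c]) simp
  qed
  then obtain c where c: "poly (Q + smult (2 * c) B + smult (c\<^sup>2) ?A) a = 0" "b = - poly (E c) a"
    by blast
  have "divisor_poly (add_mset P D) dvd (E c)\<^sup>2 - R"
    unfolding P divisor_poly_add_Aff E mult.commute[of "[:-a, 1:]"]
    using c(1) by (intro mult_dvd_mono) (simp_all only: dvd_refl poly_eq_0_iff_dvd)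
  moreover have "b' = - poly (E c) a'" if "Aff a' b' \<in># D" for a' b'
    using that B[OF that] poly_divisor_poly_eq_0_iff[of D a'] by (auto simp: E_def)
  ultimately show ?case using c(2) P by (intro exI[of _ "E c"]) auto
qed

text \<open>Reducing the interpolating \<open>B\<close> modulo \<open>A\<close> meets the degree
  bound and affects neither its values at the roots of \<open>A\<close> nor the divisibility of
  \<open>B\<^sup>2 - R\<close>; the quotient is \<open>C\<close>.\<close>

lemma triple_divisor_surj:
  assumes "alpha_admissible g \<alpha> R" "D \<in> affine_jacobi g R"
  obtains A B C where "(A, B, C) \<in> triples_with_discr g \<alpha> R" "triple_divisor (A, B, C) = D"
proof -
  let ?A = "divisor_poly D"
  have D: "size D = g" "set_mset D \<subseteq> affine_curve R" "non_special D"
    using assms by (auto simp: affine_jacobi_def)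
  have I: "Infty \<notin># D" using D by (auto simp: affine_curve_def)
  obtain B where B: "?A dvd B\<^sup>2 - R" "\<And>a b. Aff a b \<in># D \<Longrightarrow> b = - poly B a"
    using ex_interpolating_poly[OF D(2,3)] by blast
  have *: "?A * (B div ?A) = B - B mod ?A"
    by (simp add: minus_mod_eq_mult_div)
  have "(B mod ?A)\<^sup>2 - R = (B\<^sup>2 - R) - ?A * (B div ?A) * (B + B mod ?A)"
    unfolding * by (simp add: power2_eq_square algebra_simps)
  then have "?A dvd (B mod ?A)\<^sup>2 - R"
    using B(1) by (metis dvd_diff dvd_mult2 dvd_triv_left)
  then obtain C where C: "(B mod ?A)\<^sup>2 - R = ?A * C" by (auto elim: dvdE)
  have dA: "degree ?A = g" using I D by (simp add: degree_divisor_poly)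
  show thesis
  proof (rule that)
    have "degree (B mod ?A) \<le> g"
      using dA degree_mod_less[of ?A B] by auto
    then show "(?A, B mod ?A, C) \<in> triples_with_discr g \<alpha> R"
      unfolding triples_with_discr_iff[OF assms(1)]
      using dA monic_divisor_poly[of D] C by (simp add: algebra_simps)
    have "b = - poly (B mod ?A) a" if "Aff a b \<in># D" for a b
    proof -
      have "poly ?A a = 0" using that by (auto simp: poly_divisor_poly_eq_0_iff)
      then have "poly (B mod ?A) a = poly B a"
        using mult_div_mod_eq[of ?A B] by (metis add_0 mult_zero_left poly_add poly_mult)
      then show ?thesis using B(2)[OF that] by simp
    qed
    then show "triple_divisor (?A, B mod ?A, C) = D"
      by (rule triple_divisor_divisor_poly[OF I])
  qed
qed

section \<open>The bijection with the extended affine Jacobi variety\<close>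

text \<open>The sign makes the second coordinate the constant term of \<open>phi - 1 / t\<close> at
  infinity.\<close>

definition triple_coord :: "nat \<Rightarrow> triple \<Rightarrow> cpoint multiset \<times> complex" where
  "triple_coord g = (\<lambda>(A, B, C). (triple_divisor (A, B, C), - coeff B g))"

lemma bij_betw_triple_coord:
  assumes "alpha_admissible g \<alpha> R" "rsquarefree R"
  shows "bij_betw (triple_coord g) (triples_with_discr g \<alpha> R) (affine_jacobi g R \<times> UNIV)"
proof (rule bij_betwI')
  fix T T' assume T: "T \<in> triples_with_discr g \<alpha> R" "T' \<in> triples_with_discr g \<alpha> R"
  then show "triple_coord g T = triple_coord g T' \<longleftrightarrow> T = T'"
    using triple_divisor_inj[OF assms] by (cases T; cases T') (auto simp: triple_coord_def)
next
  fix T assume "T \<in> triples_with_discr g \<alpha> R"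
  then show "triple_coord g T \<in> affine_jacobi g R \<times> UNIV"
    using triple_divisor_in_affine_jacobi[OF assms] by (cases T) (auto simp: triple_coord_def)
next
  fix y assume "y \<in> affine_jacobi g R \<times> (UNIV :: complex set)"
  then obtain D \<gamma> where y: "y = (D, \<gamma>)" "D \<in> affine_jacobi g R" by auto
  obtain A B C where T: "(A, B, C) \<in> triples_with_discr g \<alpha> R" "triple_divisor (A, B, C) = D"
    using triple_divisor_surj[OF assms(1) y(2)] .
  \<comment> \<open>This shift moves the coefficient of x^g in \<open>B\<close> to
    \<open>- \<gamma>\<close>.\<close>
  note s = triple_shift[OF assms(1) T(1), of "- \<gamma> - coeff B g"]
  then show "\<exists>T\<in>triples_with_discr g \<alpha> R. y = triple_coord g T"
    using T(2) y(1) by (intro bexI[OF _ s(1)]) (simp add: triple_coord_def)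
qed

section \<open>Counting the pure periodic triples over a divisor\<close>

text \<open>\<open>b\<^sup>2 - a * c\<close> is a quarter of the discriminant, so there are two
  distinct roots by completing the square; for \<open>a = 0\<close> it forces \<open>b\<close> to be
  nonzero and the equation is linear.\<close>

lemma card_quadratic_roots:
  fixes a b c :: complex
  assumes "b\<^sup>2 - a * c \<noteq> 0"
  shows "card {x. c + 2 * x * b + x\<^sup>2 * a = 0} = (if a = 0 then 1 else 2)"
proof (cases "a = 0")
  case True
  then have "b \<noteq> 0" using assms by simp
  then have "{x. c + 2 * x * b + x\<^sup>2 * a = 0} = {- c / (2 * b)}"
    using True by (auto simp: field_simps eq_neg_iff_add_eq_0)
  then show ?thesis using True by simp
next
  case False
  define d where "d = csqrt (b\<^sup>2 - a * c)"
  have d: "d\<^sup>2 = b\<^sup>2 - a * c" "d \<noteq> 0" using assms by (auto simp: d_def)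
  have "c + 2 * x * b + x\<^sup>2 * a = 0 \<longleftrightarrow> (a * x + b)\<^sup>2 = d\<^sup>2" for x
  proof -
    have "a * (c + 2 * x * b + x\<^sup>2 * a) = (a * x + b)\<^sup>2 - d\<^sup>2"
      unfolding d by (simp add: power2_eq_square algebra_simps)
    then show ?thesis using False by (metis eq_iff_diff_eq_0 mult_eq_0_iff)
  qed
  also have "(a * x + b)\<^sup>2 = d\<^sup>2 \<longleftrightarrow> x = (d - b) / a \<or> x = (- d - b) / a" for x
    unfolding power2_eq_iff using False by (auto simp: field_simps)
  finally have "{x. c + 2 * x * b + x\<^sup>2 * a = 0} = {(d - b) / a, (- d - b) / a}" by auto
  moreover have "(d - b) / a \<noteq> (- d - b) / a" using d False by (simp add: field_simps)
  ultimately show ?thesis using False by simp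
qed

text \<open>The triples over \<open>D\<close> form the family of shifts by \<beta>, and the value of
  the third entry at \<open>z\<close> is a quadratic in \<beta> whose quarter discriminant is
  \<open>R(z)\<close>. Its top coefficient \<open>A(z)\<close> vanishes exactly when
  \<open>D\<close> has a point over \<open>z\<close>; then one of the two solutions is lost.\<close>

lemma card_pure_periodic_triples:
  assumes "alpha_admissible g \<alpha> R" "rsquarefree R" "D \<in> affine_jacobi g R"
    and nz: "poly R (\<alpha> (2 * g + 1)) \<noteq> 0"
  shows "card {T \<in> pure_periodic_triples g \<alpha> R. triple_divisor T = D} =
    (if \<exists>b. Aff (\<alpha> (2 * g + 1)) b \<in># D then 1 else 2)"
proof -
  define z where "z = \<alpha> (2 * g + 1)"
  obtain A B C where T: "(A, B, C) \<in> triples_with_discr g \<alpha> R" "triple_divisor (A, B, C) = D"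
    using triple_divisor_surj[OF assms(1,3)] .
  then have r: "lead_coeff A = 1" "B\<^sup>2 - A * C = R"
    using triples_with_discr_iff[OF assms(1)] by auto
  then have A0: "A \<noteq> 0" by auto
  define S where "S = (\<lambda>\<beta>. (A, B + smult \<beta> A, C + smult (2 * \<beta>) B + smult (\<beta>\<^sup>2) A))"
  have s: "S \<beta> \<in> triples_with_discr g \<alpha> R" "triple_divisor (S \<beta>) = D"
    "coeff (fst (snd (S \<beta>))) g = coeff B g + \<beta>" for \<beta>
    using triple_shift[OF assms(1) T(1), of \<beta>] T(2) by (simp_all add: S_def)
  let ?Z = "{\<beta>. poly C z + 2 * \<beta> * poly B z + \<beta>\<^sup>2 * poly A z = 0}"
  have "{T \<in> pure_periodic_triples g \<alpha> R. triple_divisor T = D} = S ` ?Z"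
  proof (intro equalityI subsetI)
    fix X assume X: "X \<in> {T \<in> pure_periodic_triples g \<alpha> R. triple_divisor T = D}"
    obtain A' B' C' where X': "X = (A', B', C')" by (cases X)
    have X1: "(A', B', C') \<in> triples_with_discr g \<alpha> R" "poly C' z = 0"
      using X unfolding X' z_def by (auto simp: pure_periodic_triples_def)
    \<comment> \<open>Since \<open>triple_coord\<close> is injective, a triple over \<open>D\<close>
      is the shift with its own coefficient of x^g.\<close>
    define \<beta> where "\<beta> = coeff B' g - coeff B g"
    have "triple_coord g X = triple_coord g (S \<beta>)"
      using X s(2,3)[of \<beta>] by (auto simp: triple_coord_def X' \<beta>_def S_def)
    then have "X = S \<beta>"
      using X1(1) s(1)[of \<beta>] unfolding X'
      by (rule inj_onD[OF bij_betw_imp_inj_on[OF bij_betw_triple_coord[OF assms(1,2)]]])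
    moreover from this have "\<beta> \<in> ?Z"
      using X1(2) by (simp add: X' S_def mult.assoc)
    ultimately show "X \<in> S ` ?Z" by blast
  next
    fix X assume "X \<in> S ` ?Z"
    then obtain \<beta> where \<beta>: "X = S \<beta>" "\<beta> \<in> ?Z" by blast
    then show "X \<in> {T \<in> pure_periodic_triples g \<alpha> R. triple_divisor T = D}"
      using s(1,2)[of \<beta>]
      by (simp add: pure_periodic_triples_def S_def z_def mult.assoc)
  qed
  moreover have "inj S" by (metis add_left_cancel injI s(3))
  ultimately have "card {T \<in> pure_periodic_triples g \<alpha> R. triple_divisor T = D} = card ?Z"
    by (simp add: card_image inj_on_subset)
  also have "\<dots> = (if poly A z = 0 then 1 else 2)"
    using nz r(2) by (intro card_quadratic_roots) (auto simp: z_def)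
  also have "poly A z = 0 \<longleftrightarrow> (\<exists>b. Aff z b \<in># D)"
    using A0 unfolding T(2)[symmetric] triple_divisor_simp by auto
  finally show ?thesis by (simp add: z_def)
qed

subsection \<open>The function \<open>phi\<close> in the charts of the curve\<close>

lemma eventually_poly_neq_0_at:
  fixes p :: "complex poly"
  assumes "p \<noteq> 0"
  shows "\<forall>\<^sub>F x in at a. poly p x \<noteq> 0"
proof -
  have "open (- ({x. poly p x = 0} - {a}))"
    using poly_roots_finite[OF assms] by (intro open_Compl finite_imp_closed) simp
  then show ?thesis
    unfolding eventually_at_topological by (intro exI[of _ "- ({x. poly p x = 0} - {a})"]) auto
qed

text \<open>The punctured filter as target lets a property that holds near \<open>a\<close>, but
  perhaps not at \<open>a\<close>, be pulled back to the parameter \<open>t\<close>.\<close>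

lemma filterlim_plus_at: "filterlim (\<lambda>t. a + t) (at (a :: complex)) (at 0)"
  by (auto simp: filterlim_at eventually_at_filter intro!: tendsto_eq_intros)

lemma filterlim_plus_square_at: "filterlim (\<lambda>t. a + t\<^sup>2) (at (a :: complex)) (at 0)"
  by (auto simp: filterlim_at eventually_at_filter intro!: tendsto_eq_intros)

lemma filterlim_inverse_square_at: "filterlim (\<lambda>t :: complex. 1 / t\<^sup>2) at_infinity (at 0)"
  by (auto simp: filterlim_at eventually_at_filter intro!: tendsto_eq_intros
        filterlim_divide_at_infinity[OF tendsto_const])

lemma eventually_poly_neq_0_at_infinity:
  fixes p :: "complex poly"
  assumes "p \<noteq> 0"
  shows "\<forall>\<^sub>F x in at_infinity. poly p x \<noteq> 0"
proof -
  have "bounded {x. poly p x = 0}"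
    using poly_roots_finite[OF assms] by (rule finite_imp_bounded)
  then obtain b where "\<And>x. poly p x = 0 \<Longrightarrow> norm x \<le> b"
    by (auto simp: bounded_iff)
  then show ?thesis
    unfolding eventually_at_infinity by (intro exI[of _ "b + 1"]) force
qed

lemma order_factor:
  fixes p :: "complex poly"
  assumes "p \<noteq> 0"
  obtains q where "poly q a \<noteq> 0" "\<And>t. poly p (a + t) = t ^ order a p * poly q (a + t)"
proof -
  obtain q where q: "p = [:-a, 1:] ^ order a p * q" "\<not> [:-a, 1:] dvd q"
    using order_decomp[OF assms] by blast
  show thesis
  proof
    show "poly q a \<noteq> 0" using q(2) by (simp add: poly_eq_0_iff_dvd)
    show "poly p (a + t) = t ^ order a p * poly q (a + t)" for t
      by (subst q(1)) (simp add: poly_power)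
  qed
qed

lemma zorder_powiI:
  assumes h: "h analytic_on {0}" "h 0 \<noteq> 0"
    and ev: "\<forall>\<^sub>F t in at 0. f t = h t * t powi n"
  shows "zorder f 0 = n" "f meromorphic_on {0}"
proof -
  obtain S where S: "open S" "0 \<in> S" "h holomorphic_on S"
    using h(1) by (auto simp: analytic_at)
  have "zorder (\<lambda>t. h t * t powi n) 0 = n"
    by (rule zorder_eqI[OF S h(2)]) simp
  then show "zorder f 0 = n" using zorder_cong[OF ev refl] by simp
  have "(\<lambda>t. h t * t powi n) meromorphic_on {0}"
    using h(1) by (intro meromorphic_intros analytic_on_imp_meromorphic_on) auto
  then show "f meromorphic_on {0}"
    using meromorphic_on_cong[of "{0}" f "\<lambda>t. h t * t powi n" "{0}"] ev by simp
qed

lemma analytic_on_poly [analytic_intros]: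
  "f analytic_on S \<Longrightarrow> (\<lambda>z. poly p (f z)) analytic_on S"
  by (induction p) (auto intro!: analytic_intros)

text \<open>A function of \<open>t\<^sup>2\<close> has no linear term; in the expansion at infinity
  this isolates the contribution of \<open>B\<close>.\<close>

lemma DERIV_compose_square:
  fixes f :: "complex \<Rightarrow> complex"
  assumes "(f has_field_derivative D) (at 0)"
  shows "((\<lambda>t. f (t\<^sup>2)) has_field_derivative 0) (at 0)"
proof -
  have "((\<lambda>t::complex. t\<^sup>2) has_field_derivative 0) (at 0)"
    by (auto intro!: derivative_eq_intros)
  from DERIV_chain2[of f D "\<lambda>t. t\<^sup>2", OF _ this] assms show ?thesis by simp
qed

text \<open>For nonzero \<open>t\<close> the comparison function \<open>1 / t\<close> is nonzero, so
  the convention for \<open>0 / 0\<close> in \<open>asymp_equiv\<close> does not intervene.\<close>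

lemma asymp_sqrt_iff:
  "asymp_sqrt R f \<longleftrightarrow> ((\<lambda>t. t * f (chart R Infty t)) \<longlongrightarrow> 1) (at 0)"
  unfolding asymp_sqrt_def asymp_equiv_def
  by (intro tendsto_cong) (auto simp: eventually_at_filter)

section \<open>Local parametrisations of the curve\<close>

locale odd_curve =
  fixes R :: "complex poly" and g :: nat
  assumes degree_R: "degree R = 2 * g + 1"
    and monic_R: "lead_coeff R = 1"
    and squarefree_R: "rsquarefree R"
begin

text \<open>\<open>Y\<close> is the branch of the square root of \<open>R\<close> through
  \<open>b\<close>; the argument of \<open>csqrt\<close> is \<open>1\<close> at
  \<open>t = 0\<close>, away from the cut. It involves \<open>b\<close> only through
  \<open>b\<^sup>2\<close>, so the conjugate chart carries \<open>- Y\<close>.\<close>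

lemma chart_ordinary:
  assumes "b \<noteq> 0" "b\<^sup>2 = poly R a"
  obtains Y where "Y analytic_on {0}" "Y 0 = b" "\<And>t. (Y t)\<^sup>2 = poly R (a + t)"
    "\<And>t. chart R (Aff a b) t = Aff (a + t) (Y t)"
    "\<And>t. chart R (Aff a (- b)) t = Aff (a + t) (- Y t)"
proof
  let ?Y = "\<lambda>t. b * csqrt (poly R (a + t) / b\<^sup>2)"
  have "(1 :: complex) \<notin> \<real>\<^sub>\<le>\<^sub>0" by simp
  moreover have "poly R (a + 0) / b\<^sup>2 = 1" using assms(1) by (simp flip: assms(2))
  ultimately show "?Y analytic_on {0}" by (auto intro!: analytic_intros)
  show "?Y 0 = b" using assms(1) by (simp flip: assms(2))
  show "(?Y t)\<^sup>2 = poly R (a + t)" for t using assms(1) by (simp add: power_mult_distrib)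
  show "chart R (Aff a b) t = Aff (a + t) (?Y t)" for t
    using assms by (simp add: chart_def)
  show "chart R (Aff a (- b)) t = Aff (a + t) (- ?Y t)" for t
    using assms by (simp add: chart_def)
qed

lemma branch_factor:
  assumes "poly R a = 0"
  shows "R = [:- a, 1:] * (R div [:- a, 1:])" "poly (R div [:- a, 1:]) a \<noteq> 0"
proof -
  let ?Q = "R div [:- a, 1:]"
  show eq: "R = [:- a, 1:] * ?Q"
    using assms by (metis dvd_mult_div_cancel poly_eq_0_iff_dvd)
  show "poly ?Q a \<noteq> 0"
  proof
    assume "poly ?Q a = 0"
    then have "[:- a, 1:] dvd ?Q" by (simp add: poly_eq_0_iff_dvd)
    then have "[:- a, 1:] ^ 2 dvd R"
      by (subst eq, unfold power2_eq_square) (intro mult_dvd_mono dvd_refl)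
    then show False
      using squarefree_R by (auto simp: order_divides rsquarefree_def dest!: spec[of _ a])
  qed
qed

text \<open>\<open>R\<close> has a simple root at \<open>a\<close>, so
  \<open>R (a + t\<^sup>2)\<close> is \<open>t\<^sup>2\<close> times a unit in
  \<open>t\<^sup>2\<close>. Keeping \<open>s\<close> a function of \<open>t\<^sup>2\<close> shows
  that \<open>y\<close> is odd in \<open>t\<close>: the hyperelliptic involution is the change of
  sign of \<open>t\<close>.\<close>

lemma chart_branch:
  assumes "poly R a = 0"
  obtains s where "s analytic_on {0}" "s 0 \<noteq> 0" "\<And>t. (t * s (t\<^sup>2))\<^sup>2 = poly R (a + t\<^sup>2)"
    "\<And>t. chart R (Aff a 0) t = Aff (a + t\<^sup>2) (t * s (t\<^sup>2))"
proof
  define Q where "Q = R div [:- a, 1:]"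
  note Q = branch_factor[OF assms, folded Q_def]
  let ?s = "\<lambda>u. csqrt (poly Q a) * csqrt (poly Q (a + u) / poly Q a)"
  have "(1 :: complex) \<notin> \<real>\<^sub>\<le>\<^sub>0" by simp
  then show "?s analytic_on {0}" using Q by (auto intro!: analytic_intros)
  show "?s 0 \<noteq> 0" using Q by simp
  show "(t * ?s (t\<^sup>2))\<^sup>2 = poly R (a + t\<^sup>2)" for t
    using Q(2) by (subst Q(1)) (simp add: power_mult_distrib algebra_simps)
  show "chart R (Aff a 0) t = Aff (a + t\<^sup>2) (t * ?s (t\<^sup>2))" for t
    by (simp add: chart_def Q_def Let_def mult.assoc)
qed

lemma poly_inverse_square:
  fixes t :: complex
  assumes "t \<noteq> 0"
  shows "poly p (1 / t\<^sup>2) = poly (reflect_poly p) (t\<^sup>2) / t ^ (2 * degree p)"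
  using assms poly_reflect_poly_nz[of "t\<^sup>2" p]
  by (simp add: inverse_eq_divide power_mult)

text \<open>The leading coefficient \<open>1\<close> of \<open>R\<close> is the constant term of the
  reflected polynomial, whence \<open>r 0 = 1\<close>. The odd power of \<open>t\<close> makes the
  involution again the change of sign of \<open>t\<close>.\<close>

lemma chart_infinity:
  obtains r where "r analytic_on {0}" "r 0 = 1"
    "\<And>t. t \<noteq> 0 \<Longrightarrow> (r (t\<^sup>2) / t ^ (2 * g + 1))\<^sup>2 = poly R (1 / t\<^sup>2)"
    "\<And>t. t \<noteq> 0 \<Longrightarrow> chart R Infty t = Aff (1 / t\<^sup>2) (r (t\<^sup>2) / t ^ (2 * g + 1))"
proof
  let ?r = "\<lambda>u. csqrt (poly (reflect_poly R) u)"
  have "(1 :: complex) \<notin> \<real>\<^sub>\<le>\<^sub>0" by simp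
  then show "?r analytic_on {0}" using monic_R by (auto intro!: analytic_intros)
  show "?r 0 = 1" using monic_R by simp
  show "(?r (t\<^sup>2) / t ^ (2 * g + 1))\<^sup>2 = poly R (1 / t\<^sup>2)" if "t \<noteq> 0" for t
  proof -
    have "(t ^ (2 * g + 1))\<^sup>2 = t ^ (2 * degree R)"
      unfolding degree_R by (metis mult.commute power_mult)
    then show ?thesis
      using that by (simp add: poly_inverse_square power_divide del: power_Suc)
  qed
  show "chart R Infty t = Aff (1 / t\<^sup>2) (?r (t\<^sup>2) / t ^ (2 * g + 1))" if "t \<noteq> 0" for t
    using that degree_R by (simp add: chart_def)
qed

lemma curve_cases [consumes 1, case_names ordinary branch infinity]:
  assumes "P \<in> curve R"
  obtains a b where "P = Aff a b" "b \<noteq> 0" "b\<^sup>2 = poly R a"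
    | a where "P = Aff a 0" "poly R a = 0"
    | "P = Infty"
  using assms by (fastforce simp: curve_def affine_curve_def)

text \<open>The coordinate \<open>x\<close> tends to its value at \<open>P\<close>, or to infinity,
  without attaining it, so it avoids the finitely many roots of \<open>p\<close>. Identities in
  \<open>x\<close> and \<open>y\<close> thus become identities of germs.\<close>

lemma eventually_chart:
  assumes "P \<in> curve R" "p \<noteq> 0"
  shows "\<forall>\<^sub>F t in at 0. \<exists>x y. chart R P t = Aff x y \<and> y\<^sup>2 = poly R x \<and> poly p x \<noteq> 0"
  using assms(1)
proof (cases rule: curve_cases)
  case (ordinary a b)
  then obtain Y where "\<And>t. (Y t)\<^sup>2 = poly R (a + t)" "\<And>t. chart R (Aff a b) t = Aff (a + t) (Y t)"
    using chart_ordinary by metis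
  with ordinary show ?thesis
    using eventually_compose_filterlim[OF eventually_poly_neq_0_at[OF assms(2)] filterlim_plus_at]
    by simp
next
  case (branch a)
  then obtain s where "\<And>t. (t * s (t\<^sup>2))\<^sup>2 = poly R (a + t\<^sup>2)"
    "\<And>t. chart R (Aff a 0) t = Aff (a + t\<^sup>2) (t * s (t\<^sup>2))"
    using chart_branch by metis
  with branch show ?thesis
    using eventually_compose_filterlim[OF eventually_poly_neq_0_at[OF assms(2)] filterlim_plus_square_at]
    by simp
next
  case infinity
  obtain r where r: "\<And>t. t \<noteq> 0 \<Longrightarrow> (r (t\<^sup>2) / t ^ (2 * g + 1))\<^sup>2 = poly R (1 / t\<^sup>2)"
    "\<And>t. t \<noteq> 0 \<Longrightarrow> chart R Infty t = Aff (1 / t\<^sup>2) (r (t\<^sup>2) / t ^ (2 * g + 1))"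
    using chart_infinity by metis
  have "\<forall>\<^sub>F t in at 0. poly p (1 / t\<^sup>2) \<noteq> 0"
    by (rule eventually_compose_filterlim[OF eventually_poly_neq_0_at_infinity[OF assms(2)]
          filterlim_inverse_square_at])
  moreover have "\<forall>\<^sub>F t in at 0. t \<noteq> (0 :: complex)"
    by (simp add: eventually_at_filter)
  ultimately show ?thesis
  proof eventually_elim
    case (elim t)
    then show ?case using r[of t] by (simp add: infinity)
  qed
qed

end

section \<open>Zeros and poles of \<open>phi\<close>\<close>

locale curve_triple = odd_curve +
  fixes A B C :: "complex poly"
  assumes degB: "degree B \<le> g" and degA: "degree A = g" and monicA: "lead_coeff A = 1"
    and discr: "B\<^sup>2 - A * C = R"
begin

lemma A_nz: "A \<noteq> 0"
  using monicA by auto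

lemma norm_nz: "B\<^sup>2 - R \<noteq> 0"
  using degree_square_diff[OF degree_R monic_R degB] by auto

lemma discr_poly: "poly A x * poly C x = (poly B x)\<^sup>2 - poly R x"
proof -
  have "A * C = B\<^sup>2 - R" using discr by (simp add: algebra_simps)
  then show ?thesis by (metis poly_diff poly_mult poly_power)
qed

text \<open>Rationalising the numerator:
  \<open>(- B + y) * (B + y) = R - B\<^sup>2 = - A * C\<close>. The factor \<open>A\<close> cancels,
  which shows the regularity of \<open>phi\<close> at the points \<open>(a, B(a))\<close>.\<close>

lemma phi_alt:
  assumes "y\<^sup>2 = poly R x" "poly A x \<noteq> 0" "y + poly B x \<noteq> 0"
  shows "phi (A, B, C) (Aff x y) = - poly C x / (y + poly B x)"
proof -
  have "(- poly B x + y) * (y + poly B x) = - (poly A x * poly C x)"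
    unfolding discr_poly using assms(1) by (simp add: power2_eq_square algebra_simps)
  then show ?thesis
    using assms by (simp add: field_simps)
qed

text \<open>A zero requires \<open>B\<^sup>2 = R\<close> at \<open>x\<close>, and
  \<open>B\<^sup>2 - R\<close> is a nonzero polynomial. This makes \<open>zorder\<close> meaningful
  for \<open>phi\<close> at every point.\<close>

lemma phi_nonzero:
  assumes "P \<in> curve R"
  shows "\<forall>\<^sub>F t in at 0. phi (A, B, C) (chart R P t) \<noteq> 0"
proof -
  have "A * (B\<^sup>2 - R) \<noteq> 0" using A_nz norm_nz by simp
  from eventually_chart[OF assms this] show ?thesis
  proof eventually_elim
    case (elim t)
    then obtain x y where xy: "chart R P t = Aff x y" "y\<^sup>2 = poly R x" "poly A x \<noteq> 0" "(poly B x)\<^sup>2 \<noteq> poly R x"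
      by auto
    then have "y \<noteq> poly B x" by auto
    with xy show ?case by simp
  qed
qed

text \<open>The denominator of the rationalised form is nonzero at the point, also when
  \<open>A(a) = 0\<close>. The value of \<open>h\<close> at \<open>0\<close> decides later whether
  \<open>phi\<close> vanishes there.\<close>

lemma phi_regular_ordinary:
  assumes "b \<noteq> 0" "b\<^sup>2 = poly R a" "b \<noteq> - poly B a"
  obtains h where "h analytic_on {0}" "h 0 = - poly C a / (b + poly B a)"
    "\<forall>\<^sub>F t in at 0. phi (A, B, C) (chart R (Aff a b) t) = h t"
proof -
  obtain Y where Y: "Y analytic_on {0}" "Y 0 = b" "\<And>t. (Y t)\<^sup>2 = poly R (a + t)"
    "\<And>t. chart R (Aff a b) t = Aff (a + t) (Y t)"
    using chart_ordinary[OF assms(1,2)] by metis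
  let ?h = "\<lambda>t. - poly C (a + t) / (Y t + poly B (a + t))"
  have "b + poly B a \<noteq> 0" using assms(3) by (simp add: eq_neg_iff_add_eq_0)
  then have an: "(\<lambda>t. Y t + poly B (a + t)) analytic_on {0}" "Y 0 + poly B (a + 0) \<noteq> 0"
    using Y by (auto intro!: analytic_intros)
  show thesis
  proof
    show "?h analytic_on {0}" using Y an by (auto intro!: analytic_intros)
    show "?h 0 = - poly C a / (b + poly B a)" using Y by simp
    have "\<forall>\<^sub>F t in at 0. Y t + poly B (a + t) \<noteq> 0"
      using an analytic_at_imp_isCont[OF an(1)] by (simp add: isCont_def tendsto_imp_eventually_ne)
    moreover have "\<forall>\<^sub>F t in at 0. poly A (a + t) \<noteq> 0"
      by (rule eventually_compose_filterlim[OF eventually_poly_neq_0_at[OF A_nz] filterlim_plus_at])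
    ultimately show "\<forall>\<^sub>F t in at 0. phi (A, B, C) (chart R (Aff a b) t) = ?h t"
    proof eventually_elim
      case (elim t)
      then show ?case unfolding Y(4) by (intro phi_alt Y(3)) auto
    qed
  qed
qed

text \<open>The numerator takes the value \<open>2 b\<close> at the point, which is nonzero, so the
  whole root of \<open>A\<close> becomes a pole.\<close>

lemma phi_pole_ordinary:
  assumes "b \<noteq> 0" "b\<^sup>2 = poly R a" "b = - poly B a"
  shows "ord_at R (phi (A, B, C)) (Aff a b) = - int (order a A)"
    "(\<lambda>t. phi (A, B, C) (chart R (Aff a b) t)) meromorphic_on {0}"
proof -
  obtain Y where Y: "Y analytic_on {0}" "Y 0 = b" "\<And>t. (Y t)\<^sup>2 = poly R (a + t)"
    "\<And>t. chart R (Aff a b) t = Aff (a + t) (Y t)"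
    using chart_ordinary[OF assms(1,2)] by metis
  obtain q where q: "poly q a \<noteq> 0" "\<And>t. poly A (a + t) = t ^ order a A * poly q (a + t)"
    using order_factor[OF A_nz, of a] by blast
  let ?h = "\<lambda>t. (- poly B (a + t) + Y t) / poly q (a + t)"
  have "?h analytic_on {0}" using Y q by (auto intro!: analytic_intros)
  moreover have "?h 0 \<noteq> 0" using Y q assms by (simp flip: mult_2)
  moreover have "\<forall>\<^sub>F t in at 0. phi (A, B, C) (chart R (Aff a b) t) = ?h t * t powi (- int (order a A))"
    using Y q by (intro always_eventually) (simp add: power_int_minus field_simps)
  ultimately show "ord_at R (phi (A, B, C)) (Aff a b) = - int (order a A)"
    "(\<lambda>t. phi (A, B, C) (chart R (Aff a b) t)) meromorphic_on {0}"
    unfolding ord_at_def by (rule zorder_powiI)+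
qed

lemma phi_regular_branch:
  assumes "poly A a \<noteq> 0" "poly R a = 0"
  obtains h where "h analytic_on {0}"
    "\<forall>\<^sub>F t in at 0. phi (A, B, C) (chart R (Aff a 0) t) = h t"
proof -
  obtain s where s: "s analytic_on {0}" "\<And>t. chart R (Aff a 0) t = Aff (a + t\<^sup>2) (t * s (t\<^sup>2))"
    using chart_branch[OF assms(2)] by metis
  let ?h = "\<lambda>t. (- poly B (a + t\<^sup>2) + t * s (t\<^sup>2)) / poly A (a + t\<^sup>2)"
  have "(\<lambda>t. s (t\<^sup>2)) analytic_on {0}"
    using analytic_on_compose[of "\<lambda>t. t\<^sup>2" "{0}" s] s(1) by (simp add: o_def analytic_intros)
  then have "?h analytic_on {0}" using assms by (auto intro!: analytic_intros)
  then show thesis by (rule that) (simp add: s(2))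
qed

text \<open>With \<open>x - a = t\<^sup>2\<close>, both \<open>A\<close> and \<open>B\<close> vanish
  at least like \<open>t\<^sup>2\<close>, \<open>A\<close> exactly so, and \<open>y\<close> only
  like \<open>t\<close>; the quotient has a simple pole.\<close>

lemma phi_pole_branch:
  assumes "order a A = 1" "poly B a = 0" "poly R a = 0"
  shows "ord_at R (phi (A, B, C)) (Aff a 0) = - 1"
    "(\<lambda>t. phi (A, B, C) (chart R (Aff a 0) t)) meromorphic_on {0}"
proof -
  obtain s where s: "s analytic_on {0}" "s 0 \<noteq> 0" "\<And>t. chart R (Aff a 0) t = Aff (a + t\<^sup>2) (t * s (t\<^sup>2))"
    using chart_branch[OF assms(3)] by metis
  obtain q where q: "poly q a \<noteq> 0" "\<And>t. poly A (a + t) = t * poly q (a + t)"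
    using order_factor[OF A_nz, of a] assms(1) by auto
  obtain B1 where eq: "B = [:-a, 1:] * B1"
    using assms(2) by (auto simp: poly_eq_0_iff_dvd elim: dvdE)
  then have B1: "poly B (a + t) = t * poly B1 (a + t)" for t
    by (subst eq) (simp add: algebra_simps)
  let ?h = "\<lambda>t. (- (t * poly B1 (a + t\<^sup>2)) + s (t\<^sup>2)) / poly q (a + t\<^sup>2)"
  have "(\<lambda>t. s (t\<^sup>2)) analytic_on {0}"
    using analytic_on_compose[of "\<lambda>t. t\<^sup>2" "{0}" s] s(1) by (simp add: o_def analytic_intros)
  then have "?h analytic_on {0}" using q by (auto intro!: analytic_intros)
  moreover have "?h 0 \<noteq> 0" using s q by simp
  moreover have "\<forall>\<^sub>F t in at 0. phi (A, B, C) (chart R (Aff a 0) t) = ?h t * t powi (- 1)"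
  proof -
    have "phi (A, B, C) (chart R (Aff a 0) t) = ?h t * t powi (- 1)" if "t \<noteq> 0" for t
      using that by (simp add: s(3) q(2) B1 power2_eq_square divide_simps) (simp add: algebra_simps)
    then show ?thesis by (simp add: eventually_at_filter)
  qed
  ultimately show "ord_at R (phi (A, B, C)) (Aff a 0) = - 1"
    "(\<lambda>t. phi (A, B, C) (chart R (Aff a 0) t)) meromorphic_on {0}"
    unfolding ord_at_def by (rule zorder_powiI)+
qed

text \<open>Multiplying numerator and denominator by t^(2g) turns \<open>A\<close> and
  \<open>B\<close> into polynomials in \<open>t\<^sup>2\<close> and \<open>y\<close> into
  \<open>r (t\<^sup>2) / t\<close>. In \<open>h = t * phi\<close> the only odd contribution is that
  of \<open>B\<close>, and it gives the derivative at \<open>0\<close>.\<close>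

lemma phi_infinity:
  obtains h where "h analytic_on {0}" "h 0 = 1" "(h has_field_derivative - coeff B g) (at 0)"
    "\<And>t. t \<noteq> 0 \<Longrightarrow> phi (A, B, C) (chart R Infty t) = h t / t"
proof -
  obtain r where r: "r analytic_on {0}" "r 0 = 1"
    "\<And>t. t \<noteq> 0 \<Longrightarrow> chart R Infty t = Aff (1 / t\<^sup>2) (r (t\<^sup>2) / t ^ (2 * g + 1))"
    using chart_infinity by metis
  \<comment> \<open>The factor \<open>monom 1 (g - degree B)\<close> pads the reflection to degree
    \<open>g\<close>, so the constant term is the coefficient of x^g also when \<open>B\<close> has
    smaller degree.\<close>
  define q where "q = monom 1 (g - degree B) * reflect_poly B"
  have q0: "poly q 0 = coeff B g"
    using degB by (auto simp: q_def poly_monom power_0_left coeff_eq_0)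
  have q: "poly B (1 / t\<^sup>2) = poly q (t\<^sup>2) / t ^ (2 * g)" if "t \<noteq> 0" for t
  proof -
    have "2 * g = 2 * (g - degree B) + 2 * degree B" using degB by simp
    then have "t ^ (2 * g) = (t\<^sup>2) ^ (g - degree B) * t ^ (2 * degree B)"
      by (metis power_add power_mult)
    then show ?thesis
      using that by (simp add: poly_inverse_square q_def poly_monom)
  qed
  let ?A = "reflect_poly A"
  define h where "h = (\<lambda>t. (r (t\<^sup>2) - t * poly q (t\<^sup>2)) / poly ?A (t\<^sup>2))"
  have A0: "poly ?A 0 = 1" using monicA by simp
  have "(\<lambda>t. r (t\<^sup>2)) analytic_on {0}"
    using analytic_on_compose[of "\<lambda>t. t\<^sup>2" "{0}" r] r(1) by (simp add: o_def analytic_intros)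
  then have "h analytic_on {0}" unfolding h_def using A0 by (auto intro!: analytic_intros)
  moreover have "h 0 = 1" using r A0 by (simp add: h_def)
  moreover have "(h has_field_derivative - coeff B g) (at 0)"
  proof -
    have "(r has_field_derivative deriv r 0) (at 0)"
      using r(1) by (simp add: analytic_at_imp_isCont analytic_on_imp_differentiable_at DERIV_deriv_iff_field_differentiable)
    then have "((\<lambda>t. r (t\<^sup>2)) has_field_derivative 0) (at 0)"
      by (rule DERIV_compose_square)
    moreover have "((\<lambda>t. poly q (t\<^sup>2)) has_field_derivative 0) (at 0)"
      "((\<lambda>t. poly ?A (t\<^sup>2)) has_field_derivative 0) (at 0)"
      by (rule DERIV_compose_square poly_DERIV)+
    ultimately show ?thesis
      unfolding h_def using A0 r(2) q0 by (auto intro!: derivative_eq_intros)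
  qed
  moreover have "phi (A, B, C) (chart R Infty t) = h t / t" if "t \<noteq> 0" for t
    using that degA by (simp add: r(3) h_def q poly_inverse_square[of t A] divide_simps)
  ultimately show thesis by (rule that)
qed

lemma asymp_sqrt_phi: "asymp_sqrt R (phi (A, B, C))"
proof -
  obtain h where h: "h analytic_on {0}" "h 0 = 1"
    "\<And>t. t \<noteq> 0 \<Longrightarrow> phi (A, B, C) (chart R Infty t) = h t / t"
    using phi_infinity by metis
  have "(h \<longlongrightarrow> 1) (at 0)"
    using analytic_at_imp_isCont[OF h(1)] h(2) by (simp add: isCont_def)
  then show ?thesis
    unfolding asymp_sqrt_iff
    by (rule Lim_transform_eventually) (simp add: h(3) eventually_at_filter)
qed

lemma phi_second_coeff:
  "((\<lambda>t. phi (A, B, C) (chart R Infty t) - 1 / t) \<longlongrightarrow> - coeff B g) (at 0)"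
proof -
  obtain h where h: "h 0 = 1" "(h has_field_derivative - coeff B g) (at 0)"
    "\<And>t. t \<noteq> 0 \<Longrightarrow> phi (A, B, C) (chart R Infty t) = h t / t"
    using phi_infinity by metis
  from h(2) have "((\<lambda>t. (h t - 1) / t) \<longlongrightarrow> - coeff B g) (at 0)"
    by (simp add: has_field_derivative_iff h(1))
  then show ?thesis
    by (rule Lim_transform_eventually) (simp add: h(3) eventually_at_filter diff_divide_distrib)
qed

text \<open>At a common root of \<open>A\<close> and \<open>R\<close> also \<open>B\<close>
  vanishes, so a double root of \<open>A\<close> would be a double root of \<open>R\<close>.\<close>

lemma order_at_branch_le_1:
  assumes "poly R a = 0"
  shows "order a A \<le> 1"
proof (cases "poly A a = 0")
  case True
  then have "poly B a = 0" using discr_poly[of a] assms by simp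
  then have "[:-a, 1:]\<^sup>2 dvd B\<^sup>2"
    by (intro dvd_power_same) (simp add: poly_eq_0_iff_dvd)
  moreover have "\<not> [:-a, 1:]\<^sup>2 dvd R"
    using squarefree_R by (auto simp: order_divides rsquarefree_def dest!: spec[of _ a])
  ultimately have "\<not> [:-a, 1:]\<^sup>2 dvd A"
    using discr by (metis dvd_diff dvd_mult2)
  then show ?thesis by (simp add: order_divides A_nz)
qed (simp add: order_0I)

lemma analytic_ord_ge_0:
  assumes "P \<in> curve R" "h analytic_on {0}" "\<forall>\<^sub>F t in at 0. phi (A, B, C) (chart R P t) = h t"
  shows "ord_at R (phi (A, B, C)) P \<ge> 0"
    "(\<lambda>t. phi (A, B, C) (chart R P t)) meromorphic_on {0}"
proof -
  have "\<forall>\<^sub>F t in at 0. h t \<noteq> 0"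
    using assms(3) phi_nonzero[OF assms(1)] by eventually_elim simp
  then have "zorder h 0 \<ge> 0"
    by (intro zorder_ge_0 assms eventually_frequently) auto
  then show "ord_at R (phi (A, B, C)) P \<ge> 0"
    unfolding ord_at_def using zorder_cong[OF assms(3) refl] by simp
  show "(\<lambda>t. phi (A, B, C) (chart R P t)) meromorphic_on {0}"
    using meromorphic_on_cong[of "{0}" _ h "{0}"] assms(2,3) analytic_on_imp_meromorphic_on by auto
qed

lemma phi_local:
  assumes "P \<in> curve R"
  shows "(\<lambda>t. phi (A, B, C) (chart R P t)) meromorphic_on {0} \<and>
    int (count (triple_divisor (A, B, C) + {#Infty#}) P) = max 0 (- ord_at R (phi (A, B, C)) P)"
  using assms
proof (cases rule: curve_cases)
  case (ordinary a b)
  show ?thesis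
  proof (cases "b = - poly B a")
    case True
    then show ?thesis
      using phi_pole_ordinary[OF ordinary(2,3) True] ordinary(1)
      by (simp add: count_triple_divisor[OF A_nz])
  next
    case False
    then obtain h where "h analytic_on {0}" "\<forall>\<^sub>F t in at 0. phi (A, B, C) (chart R P t) = h t"
      using phi_regular_ordinary[OF ordinary(2,3) False] ordinary(1) by metis
    from analytic_ord_ge_0[OF assms this] show ?thesis
      using False ordinary(1) by (simp add: count_triple_divisor[OF A_nz])
  qed
next
  case (branch a)
  show ?thesis
  proof (cases "poly A a = 0")
    case True
    then have "poly B a = 0" using discr_poly[of a] branch by simp
    moreover have "order a A = 1"
      using order_at_branch_le_1[OF branch(2)] True A_nz by (simp add: order_root)
    ultimately show ?thesis
      using phi_pole_branch[of a] branch by (simp add: count_triple_divisor[OF A_nz])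
  next
    case False
    then obtain h where "h analytic_on {0}" "\<forall>\<^sub>F t in at 0. phi (A, B, C) (chart R P t) = h t"
      using phi_regular_branch[OF False branch(2)] branch(1) by metis
    from analytic_ord_ge_0[OF assms this] show ?thesis
      using False branch(1) by (simp add: count_triple_divisor[OF A_nz] order_0I)
  qed
next
  case infinity
  obtain h where h: "h analytic_on {0}" "h 0 = 1"
    "\<And>t. t \<noteq> 0 \<Longrightarrow> phi (A, B, C) (chart R Infty t) = h t / t"
    using phi_infinity by metis
  have ev: "\<forall>\<^sub>F t in at 0. phi (A, B, C) (chart R Infty t) = h t * t powi (-1)"
    by (simp add: h(3) eventually_at_filter field_simps)
  have "count (triple_divisor (A, B, C)) Infty = 0"
    using Infty_notin_triple_divisor by (simp add: not_in_iff)
  then show ?thesis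
    using zorder_powiI[OF h(1) _ ev] h(2) unfolding infinity ord_at_def by simp
qed

lemma has_pole_divisor_phi:
  assumes "triple_divisor (A, B, C) \<in> affine_jacobi g R"
  shows "has_pole_divisor R (phi (A, B, C)) (triple_divisor (A, B, C) + {#Infty#})"
proof -
  have "\<not> mero_eq R (phi (A, B, C)) (\<lambda>_. 0)"
  proof
    assume "mero_eq R (phi (A, B, C)) (\<lambda>_. 0)"
    then have "\<forall>\<^sub>F t in at 0. phi (A, B, C) (chart R Infty t) = 0"
      by (auto simp: mero_eq_def curve_def)
    moreover have "\<forall>\<^sub>F t in at 0. phi (A, B, C) (chart R Infty t) \<noteq> 0"
      by (rule phi_nonzero) (simp add: curve_def)
    ultimately have "\<forall>\<^sub>F t in at (0::complex). False" by eventually_elim simp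
    then show False by simp
  qed
  then show ?thesis
    using phi_local assms
    by (auto simp: has_pole_divisor_def mero_curve_def affine_jacobi_def curve_def)
qed

text \<open>By the form \<open>- C / (y + B)\<close>, the value is zero exactly for
  \<open>C(z) = 0\<close> at points with \<open>y\<close> different from \<open>- B(z)\<close>. The
  assumption on \<open>R\<close> makes both points over \<open>z\<close> ordinary.\<close>

lemma phi_vanishes_over_iff:
  assumes nz: "poly R z \<noteq> 0"
  shows "(\<exists>b. Aff z b \<in> affine_curve R \<and> vanishes_at R (phi (A, B, C)) (Aff z b)) \<longleftrightarrow> poly C z = 0"
proof -
  have reg: "vanishes_at R (phi (A, B, C)) (Aff z b) \<longleftrightarrow> poly C z = 0"
    if b: "b \<noteq> 0" "b\<^sup>2 = poly R z" "b \<noteq> - poly B z" for b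
  proof -
    obtain h where h: "h analytic_on {0}" "h 0 = - poly C z / (b + poly B z)"
      "\<forall>\<^sub>F t in at 0. phi (A, B, C) (chart R (Aff z b) t) = h t"
      using phi_regular_ordinary[OF b] by blast
    have "(h \<longlongrightarrow> h 0) (at 0)"
      using analytic_at_imp_isCont[OF h(1)] by (simp add: isCont_def)
    then have "(h \<longlongrightarrow> 0) (at 0) \<longleftrightarrow> h 0 = 0"
      using tendsto_unique[OF trivial_limit_at] by metis
    moreover have "vanishes_at R (phi (A, B, C)) (Aff z b) \<longleftrightarrow> (h \<longlongrightarrow> 0) (at 0)"
      unfolding vanishes_at_def using h(3) by (rule tendsto_cong)
    moreover have "b + poly B z \<noteq> 0" using b(3) by (simp add: eq_neg_iff_add_eq_0)
    ultimately show ?thesis using h(2) by simp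
  qed
  \<comment> \<open>Here \<open>A * phi\<close> tends to \<open>- B(z) + b = 2 b\<close>, which is
    nonzero, so \<open>phi\<close> cannot tend to \<open>0\<close>, whether or not
    \<open>A(z) = 0\<close>.\<close>
  have pole: "\<not> vanishes_at R (phi (A, B, C)) (Aff z b)"
    if b: "b \<noteq> 0" "b\<^sup>2 = poly R z" "b = - poly B z" for b
  proof
    assume v: "vanishes_at R (phi (A, B, C)) (Aff z b)"
    obtain Y where Y: "Y analytic_on {0}" "Y 0 = b" "\<And>t. chart R (Aff z b) t = Aff (z + t) (Y t)"
      using chart_ordinary[OF b(1,2)] by metis
    have "((\<lambda>t. poly A (z + t) * phi (A, B, C) (chart R (Aff z b) t)) \<longlongrightarrow> poly A (z + 0) * 0) (at 0)"
      using v unfolding vanishes_at_def by (intro tendsto_intros)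
    moreover have "\<forall>\<^sub>F t in at 0. poly A (z + t) * phi (A, B, C) (chart R (Aff z b) t) = - poly B (z + t) + Y t"
      using eventually_compose_filterlim[OF eventually_poly_neq_0_at[OF A_nz] filterlim_plus_at[of z]]
      by (rule eventually_mono) (simp add: Y(3))
    ultimately have "((\<lambda>t. - poly B (z + t) + Y t) \<longlongrightarrow> poly A (z + 0) * 0) (at 0)"
      by (rule Lim_transform_eventually)
    moreover have "((\<lambda>t. - poly B (z + t) + Y t) \<longlongrightarrow> - poly B (z + 0) + b) (at 0)"
      using analytic_at_imp_isCont[OF Y(1)] Y(2) by (intro tendsto_intros) (simp add: isCont_def)
    ultimately have "poly A (z + 0) * 0 = - poly B (z + 0) + b"
      by (rule tendsto_unique[OF trivial_limit_at])
    then show False using b by (simp flip: mult_2)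
  qed
  show ?thesis
  proof
    assume "\<exists>b. Aff z b \<in> affine_curve R \<and> vanishes_at R (phi (A, B, C)) (Aff z b)"
    then obtain b where b: "b\<^sup>2 = poly R z" "vanishes_at R (phi (A, B, C)) (Aff z b)"
      by (auto simp: affine_curve_def)
    then have "b \<noteq> 0" using nz by auto
    then show "poly C z = 0" using reg pole b by blast
  next
    assume C0: "poly C z = 0"
    \<comment> \<open>As \<open>C(z) = 0\<close>, the point \<open>(z, B(z))\<close> lies on the
      curve, and there the numerator of \<open>phi\<close> vanishes.\<close>
    define b where "b = poly B z"
    have b: "b\<^sup>2 = poly R z" using discr_poly[of z] C0 by (simp add: b_def)
    then have "b \<noteq> 0" using nz by auto
    moreover from this have "b \<noteq> - poly B z" by (simp add: b_def eq_neg_iff_add_eq_0 flip: mult_2)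
    ultimately show "\<exists>b. Aff z b \<in> affine_curve R \<and> vanishes_at R (phi (A, B, C)) (Aff z b)"
      using reg b C0 by (intro exI[of _ b]) (auto simp: affine_curve_def)
  qed
qed

end

subsection \<open>Entire extensions\<close>

lemma meromorphic_on_poly [meromorphic_intros]:
  "f meromorphic_on S \<Longrightarrow> (\<lambda>z. poly p (f z)) meromorphic_on S"
  by (induction p) (auto intro!: meromorphic_intros)

text \<open>Multiplication by \<open>t ^ n\<close> leaves a nonnegative exponent in the
  factorisation by \<open>zor_poly\<close>. The germ that vanishes identically is separate because
  \<open>zorder\<close> says nothing about it.\<close>

lemma meromorphic_removable:
  assumes "F meromorphic_on {0}" "zorder F 0 + int n \<ge> 0"
  obtains h where "h analytic_on {0}" "\<forall>\<^sub>F t in at 0. t ^ n * F t = h t"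
proof (cases "\<exists>\<^sub>F t in at 0. F t \<noteq> 0")
  case True
  define m where "m = nat (zorder F 0 + int n)"
  let ?h = "zor_poly F 0"
  obtain r where r: "r > 0" "?h holomorphic_on cball 0 r"
    "\<And>w. w \<in> cball 0 r - {0} \<Longrightarrow> F w = ?h w * (w - 0) powi zorder F 0"
    using zorder_exist[of F 0] assms(1) True by (auto simp: meromorphic_at_iff)
  have "?h analytic_on {0}"
    using r(1,2) unfolding analytic_at
    by (intro exI[of _ "ball 0 r"]) (auto intro: holomorphic_on_subset)
  then have "(\<lambda>t. t ^ m * ?h t) analytic_on {0}" by (intro analytic_intros)
  moreover have "\<forall>\<^sub>F t in at 0. t ^ n * F t = t ^ m * ?h t"
    unfolding eventually_at
  proof (intro exI[of _ r] conjI ballI impI r(1))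
    fix t :: complex assume t: "t \<noteq> 0 \<and> dist t 0 < r"
    then have "t ^ m = t powi (int n + zorder F 0)"
      using assms(2) by (simp add: m_def power_int_def add.commute)
    also have "\<dots> = t ^ n * t powi (zorder F 0)" using t by (simp add: power_int_add)
    finally show "t ^ n * F t = t ^ m * ?h t" using t r(3)[of t] by simp
  qed
  ultimately show thesis by (rule that)
next
  case False
  then have "\<forall>\<^sub>F t in at 0. t ^ n * F t = 0"
    by (simp add: not_frequently eventually_mono)
  then show thesis by (intro that[of "\<lambda>_. 0"]) auto
qed

lemma meromorphic_zero_or_nonzero:
  assumes "F meromorphic_on {z}"
  shows "(\<forall>\<^sub>F t in at z. F t = 0) \<or> (\<forall>\<^sub>F t in at z. F t \<noteq> 0)"
  using assms non_zero_neighbour[of F z] by (auto simp: meromorphic_at_iff frequently_def)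

text \<open>\<open>csqrt (x - a)\<close> inverts the substitution; it tends to \<open>0\<close> in
  spite of the branch cut, because its modulus does.\<close>

lemma tendsto_at_square:
  fixes G :: "complex \<Rightarrow> complex"
  assumes "((\<lambda>t. G (a + t\<^sup>2)) \<longlongrightarrow> c) (at 0)"
  shows "(G \<longlongrightarrow> c) (at a)"
proof -
  have "((\<lambda>x. csqrt (x - a)) \<longlongrightarrow> 0) (at a)"
  proof -
    have "((\<lambda>x. sqrt (cmod (x - a))) \<longlongrightarrow> 0) (at a)"
      by (auto intro!: tendsto_eq_intros)
    then show ?thesis by (subst tendsto_norm_zero_iff[symmetric]) simp
  qed
  then have "filterlim (\<lambda>x. csqrt (x - a)) (at 0) (at a)"
    by (auto simp: filterlim_at eventually_at_filter)
  from filterlim_compose[OF assms this] show ?thesis by simp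
qed

lemma tendsto_at_infinity_square:
  fixes G :: "complex \<Rightarrow> complex"
  assumes "((\<lambda>t. G (1 / t\<^sup>2)) \<longlongrightarrow> c) (at 0)"
  shows "(G \<longlongrightarrow> c) at_infinity"
proof -
  have "((\<lambda>x::complex. inverse x) \<longlongrightarrow> 0) at_infinity" by (rule tendsto_inverse_0)
  then have "((\<lambda>x::complex. sqrt (cmod (inverse x))) \<longlongrightarrow> sqrt (cmod 0)) at_infinity"
    by (intro tendsto_intros)
  then have "((\<lambda>x. csqrt (inverse x)) \<longlongrightarrow> 0) at_infinity"
    by (subst tendsto_norm_zero_iff[symmetric]) simp
  moreover have "\<forall>\<^sub>F x :: complex in at_infinity. x \<noteq> 0"
    by (auto simp: eventually_at_infinity intro!: exI[of _ 1])
  ultimately have "filterlim (\<lambda>x. csqrt (inverse x)) (at 0) at_infinity"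
    by (auto simp: filterlim_at elim: eventually_mono)
  from filterlim_compose[OF assms this] show ?thesis by (simp add: divide_inverse)
qed

text \<open>This passes estimates from a function to its limit function, from which it may differ at
  isolated points.\<close>

lemma norm_limit_le:
  fixes G H :: "complex \<Rightarrow> complex"
  assumes "open S" "x \<in> S" "\<And>z. z \<in> S \<Longrightarrow> norm (G z - c) \<le> k z" "isCont k x" "(G \<longlongrightarrow> l) (at x)"
  shows "norm (l - c) \<le> k x"
proof (rule tendsto_le[OF _ _ _])
  show "(k \<longlongrightarrow> k x) (at x)" using assms(4) by (simp add: isCont_def)
  show "((\<lambda>z. norm (G z - c)) \<longlongrightarrow> norm (l - c)) (at x)" using assms(5) by (intro tendsto_intros)
  show "\<forall>\<^sub>F z in at x. norm (G z - c) \<le> k z"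
    using assms(1-3) by (auto simp: eventually_at_topological)
qed simp

text \<open>A function with a limit everywhere has a continuous limit function, so only finitely many
  removable singularities remain to be removed.\<close>
lemma entire_extension:
  fixes G :: "complex \<Rightarrow> complex"
  assumes K: "finite K"
    and an: "\<And>a. a \<notin> K \<Longrightarrow> \<exists>h. h analytic_on {0} \<and> (\<forall>\<^sub>F t in at 0. G (a + t) = h t)"
    and lim: "\<And>a. a \<in> K \<Longrightarrow> \<exists>c. (G \<longlongrightarrow> c) (at a)"
  obtains H where "H holomorphic_on UNIV" "\<And>a. (G \<longlongrightarrow> H a) (at a)"
    "\<And>a. a \<notin> K \<Longrightarrow> \<forall>\<^sub>F x in at a. G x = H x"
proof -
  have lim': "\<exists>c. (G \<longlongrightarrow> c) (at a)" for a
  proof (cases "a \<in> K")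
    case False
    then obtain h where h: "h analytic_on {0}" "\<forall>\<^sub>F t in at 0. G (a + t) = h t"
      using an by blast
    have "(h \<longlongrightarrow> h 0) (at 0)" using analytic_at_imp_isCont[OF h(1)] by (simp add: isCont_def)
    then have "((\<lambda>t. G (a + t)) \<longlongrightarrow> h 0) (at 0)"
      using h(2) by (simp add: tendsto_cong)
    then show ?thesis using LIM_offset_zero_cancel by blast
  qed (rule lim)
  define H where "H a = Lim (at a) G" for a
  have H: "(G \<longlongrightarrow> H a) (at a)" for a
    using lim'[of a] unfolding H_def by (metis tendsto_Lim trivial_limit_at)
  have HI: "H a = c" if "(G \<longlongrightarrow> c) (at a)" for a c
    using tendsto_unique[OF _ H that] by simp
  have local: "\<exists>h r. r > 0 \<and> h holomorphic_on ball 0 r \<and>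
      (\<forall>t\<in>ball 0 r. H (a + t) = h t) \<and> (\<forall>t\<in>ball 0 r - {0}. G (a + t) = h t)" if aK: "a \<notin> K" for a
  proof -
    obtain h where h: "h analytic_on {0}" "\<forall>\<^sub>F t in at 0. G (a + t) = h t"
      using an[OF aK] by blast
    obtain r1 where r1: "r1 > 0" "h holomorphic_on ball 0 r1"
      using h(1) by (auto simp: analytic_on_def)
    obtain r2 where r2: "r2 > 0" "\<And>t. t \<noteq> 0 \<Longrightarrow> norm t < r2 \<Longrightarrow> G (a + t) = h t"
      using h(2) by (auto simp: eventually_at)
    define r where "r = min r1 r2"
    have r: "r > 0" "h holomorphic_on ball 0 r"
      using r1 r2 by (auto simp: r_def intro: holomorphic_on_subset)
    have G: "G (a + t) = h t" if "t \<in> ball 0 r - {0}" for t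
      using that r2 by (auto simp: r_def)
    have "H (a + t) = h t" if t: "t \<in> ball 0 r" for t
    proof (rule HI)
      have "(h \<longlongrightarrow> h t) (at t)"
        using r(2) t by (metis continuous_on_eq_continuous_at holomorphic_on_imp_continuous_on isCont_def open_ball)
      \<comment> \<open>Equality of \<open>G (a + s)\<close> and \<open>h s\<close> is known for
        nonzero \<open>s\<close>; at \<open>t = 0\<close> the punctured filter excludes
        \<open>s = 0\<close>, elsewhere the open set does.\<close>
      moreover have "\<forall>\<^sub>F s in at t. h s = G (a + s)"
        using t G unfolding eventually_at_topological
        by (intro exI[of _ "if t = 0 then ball 0 r else ball 0 r - {0}"]) auto
      ultimately have "((\<lambda>s. G (a + s)) \<longlongrightarrow> h t) (at t)"
        by (rule Lim_transform_eventually)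
      then show "(G \<longlongrightarrow> h t) (at (a + t))"
        using LIM_offset_zero_iff[of "a + t" G "h t"] LIM_offset_zero_iff[of t "\<lambda>s. G (a + s)" "h t"]
        by (simp add: add.assoc)
    qed
    with r G show ?thesis by blast
  qed
  have "H holomorphic_on UNIV"
  proof (rule no_isolated_singularity'[OF _ _ open_UNIV K])
    show "H holomorphic_on UNIV - K"
      unfolding holomorphic_on_def
    proof
      fix a assume "a \<in> UNIV - K"
      then obtain h r where hr: "r > 0" "h holomorphic_on ball 0 r" "\<forall>t\<in>ball 0 r. H (a + t) = h t"
        using local by blast
      have "(\<lambda>x. h (x - a)) holomorphic_on ball a r"
        by (rule holomorphic_on_compose_gen[OF _ hr(2), of _ "ball a r", unfolded o_def])
          (auto intro!: holomorphic_intros simp: dist_norm norm_minus_commute)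
      moreover have "h (x - a) = H x" if "x \<in> ball a r" for x
        using hr(3)[rule_format, of "x - a"] that by (simp add: dist_norm norm_minus_commute)
      ultimately have "H holomorphic_on ball a r"
        by (rule holomorphic_transform)
      then have "H field_differentiable at a"
        using hr(1) by (intro holomorphic_on_imp_differentiable_at[OF _ open_ball]) auto
      then show "H field_differentiable at a within UNIV - K"
        by (rule field_differentiable_at_within)
    qed
    fix a assume "a \<in> K"
    show "(H \<longlongrightarrow> H a) (at a within UNIV)"
    proof (rule LIM_I)
      fix e :: real assume e: "e > 0"
      \<comment> \<open>Half of \<open>e\<close>, since the strict inequality becomes weak in the
        limit that defines \<open>H x\<close>.\<close>
      obtain d where d: "d > 0" "\<And>x. x \<noteq> a \<Longrightarrow> norm (x - a) < d \<Longrightarrow> norm (G x - H a) < e / 2"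
        using LIM_D[OF H, of "e / 2" a] e by auto
      have "norm (H x - H a) \<le> e / 2" if "x \<noteq> a" "norm (x - a) < d" for x
        by (rule norm_limit_le[of "ball a d - {a}" _ G _ "\<lambda>_. e / 2"])
           (use that d(2) H in \<open>auto simp: dist_norm norm_minus_commute less_imp_le\<close>)
      then show "\<exists>s>0. \<forall>x. x \<noteq> a \<and> norm (x - a) < s \<longrightarrow> norm (H x - H a) < e"
        using d(1) e by (intro exI[of _ d]) force
    qed
  qed
  moreover have "\<forall>\<^sub>F x in at a. G x = H x" if aK: "a \<notin> K" for a
  proof -
    obtain h r where hr: "r > 0" "\<forall>t\<in>ball 0 r. H (a + t) = h t" "\<forall>t\<in>ball 0 r - {0}. G (a + t) = h t"
      using local[OF aK] by blast
    have "G x = H x" if "x \<noteq> a" "dist x a < r" for x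
      using hr(2,3)[rule_format, of "x - a"] that by (simp add: dist_norm norm_minus_commute)
    then show ?thesis using hr(1) by (auto simp: eventually_at)
  qed
  ultimately show thesis using H that by blast
qed

text \<open>The symmetric difference quotient; it describes an odd part divided by \<open>t\<close>
  at branch points and at infinity.\<close>

lemma tendsto_odd_quotient:
  fixes h :: "complex \<Rightarrow> complex"
  assumes "h analytic_on {0}"
  shows "((\<lambda>t. (h t - h (- t)) / (2 * t)) \<longlongrightarrow> deriv h 0) (at 0)"
proof -
  have h: "(h has_field_derivative deriv h 0) (at 0)"
    using assms by (simp add: analytic_on_imp_differentiable_at DERIV_deriv_iff_field_differentiable)
  then have "((\<lambda>t. h (- t)) has_field_derivative - deriv h 0) (at 0)"
    using DERIV_chain2[of h "deriv h 0" "\<lambda>t. - t" 0 "-1" UNIV] DERIV_minus[OF DERIV_ident, of 0 UNIV]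
    by simp
  from DERIV_diff[OF h this] have "((\<lambda>t. (h t - h (- t)) / t) \<longlongrightarrow> 2 * deriv h 0) (at 0)"
    by (simp add: has_field_derivative_iff)
  then have "((\<lambda>t. (h t - h (- t)) / t / 2) \<longlongrightarrow> 2 * deriv h 0 / 2) (at 0)"
    by (intro tendsto_intros) auto
  then show ?thesis by (simp add: mult.commute)
qed

lemma tendsto_analytic_square:
  assumes "f analytic_on {0}"
  shows "((\<lambda>t. f (t\<^sup>2)) \<longlongrightarrow> f 0) (at 0)"
proof -
  have "(f \<longlongrightarrow> f 0) (at 0)"
    using analytic_at_imp_isCont[OF assms] by (simp add: isCont_def)
  from filterlim_compose[OF this] show ?thesis
    using filterlim_plus_square_at[of 0] by simp
qed

lemma filterlim_uminus_at_0: "filterlim uminus (at (0 :: complex)) (at 0)"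
  by (auto simp: filterlim_at eventually_at_filter intro!: tendsto_eq_intros)

text \<open>If the order of \<open>p\<close> at \<open>a\<close> were smaller than \<open>m\<close>,
  division by that power of \<open>t\<close> would leave a unit on one side and something tending to
  \<open>0\<close> on the other.\<close>

lemma power_dvd_if_quotient_cont:
  fixes p :: "complex poly"
  assumes k: "isCont k 0" and ev: "\<forall>\<^sub>F t in at 0. poly p (a + t) = t ^ m * k t"
  shows "[:-a, 1:] ^ m dvd p"
proof (cases "p = 0")
  case False
  show ?thesis
  proof (rule ccontr)
    assume "\<not> ?thesis"
    then have lt: "order a p < m" by (simp add: order_divides False)
    obtain q where q: "poly q a \<noteq> 0" "\<And>t. poly p (a + t) = t ^ order a p * poly q (a + t)"
      using order_factor[OF False] by blast
    have "\<forall>\<^sub>F t in at 0. t ^ (m - order a p) * k t = poly q (a + t)"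
      using ev eventually_neq_at_within[of 0 0 UNIV]
    proof eventually_elim
      case (elim t)
      then have "t ^ order a p * poly q (a + t) = t ^ order a p * (t ^ (m - order a p) * k t)"
        using lt by (simp add: q(2)[symmetric] mult.assoc[symmetric] power_add[symmetric])
      then show ?case using elim by simp
    qed
    moreover have "((\<lambda>t. t ^ (m - order a p) * k t) \<longlongrightarrow> 0 ^ (m - order a p) * k 0) (at 0)"
      using k by (intro tendsto_intros) (simp add: isCont_def)
    ultimately have "((\<lambda>t. poly q (a + t)) \<longlongrightarrow> 0 ^ (m - order a p) * k 0) (at 0)"
      by (simp add: tendsto_cong)
    moreover have "((\<lambda>t. poly q (a + t)) \<longlongrightarrow> poly q (a + 0)) (at 0)"
      by (intro tendsto_intros)
    ultimately have "poly q (a + 0) = 0 ^ (m - order a p) * k 0"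
      using tendsto_unique[OF trivial_limit_at] by blast
    then show False using lt q(1) by simp
  qed
qed simp

subsection \<open>Functions with bounded poles\<close>

context odd_curve
begin

text \<open>The last property says that \<open>x\<close> is not locally constant at a parameter
  other than \<open>0\<close>: for nonzero \<open>t\<close> the squares separate points near
  \<open>t\<close>. It transports statements about \<open>x\<close> to chart points off the
  centre.\<close>

lemma chart_coords:
  assumes "P \<in> curve R"
  obtains X Y where "X meromorphic_on {0}" "Y meromorphic_on {0}"
    "\<And>t. t \<noteq> 0 \<Longrightarrow> chart R P t = Aff (X t) (Y t)"
    "\<And>t. t \<noteq> 0 \<Longrightarrow> filterlim X (at (X t)) (at t)"
  using assms
proof (cases rule: curve_cases)
  case (ordinary a b)
  then obtain Y where Y: "Y analytic_on {0}" "\<And>t. chart R (Aff a b) t = Aff (a + t) (Y t)"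
    using chart_ordinary by metis
  show thesis
  proof
    show "filterlim (\<lambda>t. a + t) (at (a + t)) (at t)" for t
      by (auto simp: filterlim_at eventually_at_filter intro!: tendsto_eq_intros)
  qed (use Y ordinary in \<open>auto intro!: meromorphic_intros analytic_on_imp_meromorphic_on analytic_intros\<close>)
next
  case (branch a)
  then obtain s where s: "s analytic_on {0}" "\<And>t. chart R (Aff a 0) t = Aff (a + t\<^sup>2) (t * s (t\<^sup>2))"
    using chart_branch by metis
  have "(\<lambda>t. s (t\<^sup>2)) analytic_on {0}"
    using analytic_on_compose[of "\<lambda>t. t\<^sup>2" "{0}" s] s(1) by (simp add: o_def analytic_intros)
  then have Y: "(\<lambda>t. t * s (t\<^sup>2)) analytic_on {0}" by (intro analytic_intros)
  show thesis
  proof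
    fix t :: complex assume "t \<noteq> 0"
    have "\<forall>\<^sub>F u in at t. u \<noteq> - t"
      using \<open>t \<noteq> 0\<close> by (intro tendsto_imp_eventually_ne[OF tendsto_ident_at]) (simp add: eq_neg_iff_add_eq_0)
    then have "\<forall>\<^sub>F u in at t. u\<^sup>2 \<noteq> t\<^sup>2"
      using eventually_neq_at_within[of t t UNIV] by eventually_elim (simp add: power2_eq_iff)
    then show "filterlim (\<lambda>t. a + t\<^sup>2) (at (a + t\<^sup>2)) (at t)"
      by (auto simp: filterlim_at intro!: tendsto_eq_intros)
  qed (use Y s branch in \<open>auto intro!: meromorphic_intros analytic_on_imp_meromorphic_on analytic_intros\<close>)
next
  case infinity
  obtain r where r: "r analytic_on {0}"
    "\<And>t. t \<noteq> 0 \<Longrightarrow> chart R Infty t = Aff (1 / t\<^sup>2) (r (t\<^sup>2) / t ^ (2 * g + 1))"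
    using chart_infinity by metis
  have "(\<lambda>t. r (t\<^sup>2)) analytic_on {0}"
    using analytic_on_compose[of "\<lambda>t. t\<^sup>2" "{0}" r] r(1) by (simp add: o_def analytic_intros)
  then have "(\<lambda>t. r (t\<^sup>2)) meromorphic_on {0}" by (rule analytic_on_imp_meromorphic_on)
  then have Y: "(\<lambda>t. r (t\<^sup>2) / t ^ (2 * g + 1)) meromorphic_on {0}" by (intro meromorphic_intros)
  show thesis
  proof
    fix t :: complex assume "t \<noteq> 0"
    have "\<forall>\<^sub>F u in at t. u \<noteq> - t"
      using \<open>t \<noteq> 0\<close> by (intro tendsto_imp_eventually_ne[OF tendsto_ident_at]) (simp add: eq_neg_iff_add_eq_0)
    then have "\<forall>\<^sub>F u in at t. 1 / u\<^sup>2 \<noteq> 1 / t\<^sup>2"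
      using eventually_neq_at_within[of t t UNIV] by eventually_elim (simp add: power2_eq_iff)
    then show "filterlim (\<lambda>t. 1 / t\<^sup>2) (at (1 / t\<^sup>2)) (at t)"
      using \<open>t \<noteq> 0\<close> by (auto simp: filterlim_at intro!: tendsto_eq_intros)
  qed (use Y r infinity in \<open>auto intro!: meromorphic_intros\<close>)
qed

text \<open>In a chart the difference either vanishes near the centre or has no zero in a punctured
  disc. The second is refuted at any point of that disc, which lies over an ordinary
  \<open>x\<close>; so branch points and infinity are covered by continuation.\<close>

lemma mero_eqI_ordinary:
  assumes f: "mero_curve R f" and h: "mero_curve R h"
    and eq: "\<And>a. poly R a \<noteq> 0 \<Longrightarrow>
      \<forall>\<^sub>F x in at a. \<forall>y. y\<^sup>2 = poly R x \<longrightarrow> f (Aff x y) = h (Aff x y)"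
  shows "mero_eq R f h"
  unfolding mero_eq_def
proof
  fix P assume P: "P \<in> curve R"
  obtain X Y where XY: "\<And>t. t \<noteq> 0 \<Longrightarrow> chart R P t = Aff (X t) (Y t)"
    "\<And>t. t \<noteq> 0 \<Longrightarrow> filterlim X (at (X t)) (at t)"
    using chart_coords[OF P] by metis
  have "R \<noteq> 0" using degree_R by auto
  have ch: "\<forall>\<^sub>F t in at 0. \<exists>x y. chart R P t = Aff x y \<and> y\<^sup>2 = poly R x \<and> poly R x \<noteq> 0"
    by (rule eventually_chart[OF P \<open>R \<noteq> 0\<close>])
  let ?F = "\<lambda>t. f (chart R P t) - h (chart R P t)"
  have "?F meromorphic_on {0}"
    using f h P by (intro meromorphic_intros) (auto simp: mero_curve_def)
  then consider "\<forall>\<^sub>F t in at 0. ?F t = 0" | "\<forall>\<^sub>F t in at 0. ?F t \<noteq> 0"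
    using meromorphic_zero_or_nonzero by blast
  then show "\<forall>\<^sub>F t in at 0. f (chart R P t) = h (chart R P t)"
  proof cases
    case 2
    then have "\<forall>\<^sub>F t in at 0. ?F t \<noteq> 0 \<and> (\<exists>x y. chart R P t = Aff x y \<and> y\<^sup>2 = poly R x \<and> poly R x \<noteq> 0)"
      using ch by eventually_elim blast
    then obtain r where r: "r > 0" "\<And>t. t \<noteq> 0 \<Longrightarrow> norm t < r \<Longrightarrow>
        ?F t \<noteq> 0 \<and> (\<exists>x y. chart R P t = Aff x y \<and> y\<^sup>2 = poly R x \<and> poly R x \<noteq> 0)"
      by (auto simp: eventually_at)
    define u where "u = complex_of_real (r / 2)"
    have u: "u \<noteq> 0" "norm u < r" using r(1) by (auto simp: u_def)
    then have "poly R (X u) \<noteq> 0" using r(2)[OF u] XY(1)[of u] by auto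
    from eventually_compose_filterlim[OF eq[OF this] XY(2)[OF u(1)]]
    have "\<forall>\<^sub>F t in at u. \<forall>y. y\<^sup>2 = poly R (X t) \<longrightarrow> f (Aff (X t) y) = h (Aff (X t) y)" .
    moreover have "\<forall>\<^sub>F t in at u. t \<in> ball 0 r - {0}"
      using u by (intro eventually_at_in_open') auto
    ultimately have "\<forall>\<^sub>F t in at u. False"
    proof eventually_elim
      case (elim t)
      then have t: "t \<noteq> 0" "norm t < r" by auto
      then show ?case using elim(1) r(2)[OF t] XY(1)[OF t(1)] by auto
    qed
    then show ?thesis by simp
  qed simp
qed

lemma mero_curve_phi: "mero_curve R (phi (A, B, C))"
  unfolding mero_curve_def
proof
  fix P assume P: "P \<in> curve R"
  obtain X Y where XY: "X meromorphic_on {0}" "Y meromorphic_on {0}"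
    "\<And>t. t \<noteq> 0 \<Longrightarrow> chart R P t = Aff (X t) (Y t)"
    using chart_coords[OF P] by metis
  have "(\<lambda>t. (- poly B (X t) + Y t) / poly A (X t)) meromorphic_on {0}"
    using XY by (intro meromorphic_intros)
  moreover have "\<forall>\<^sub>F t in at 0. phi (A, B, C) (chart R P t) = (- poly B (X t) + Y t) / poly A (X t)"
    by (simp add: eventually_at_filter XY(3))
  ultimately show "(\<lambda>t. phi (A, B, C) (chart R P t)) meromorphic_on {0}"
    using meromorphic_on_cong[of "{0}" "\<lambda>t. phi (A, B, C) (chart R P t)" "\<lambda>t. (- poly B (X t) + Y t) / poly A (X t)" "{0}"] by simp
qed

end

section \<open>Functions with poles bounded by the divisor and asymptotic to the square root\<close>

locale curve_triple_function = curve_triple +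
  fixes f :: "cpoint \<Rightarrow> complex"
  assumes fL: "f \<in> L_space R (triple_divisor (A, B, C) + {#Infty#})"
    and f_asymp: "asymp_sqrt R f"
begin

text \<open>The asymptotic \<open>1 / t\<close> excludes the zero function, so membership in
  \<open>L_space\<close> bounds the orders.\<close>

lemma pole_bound:
  assumes "P \<in> curve R"
  obtains h where "h analytic_on {0}"
    "\<forall>\<^sub>F t in at 0. t ^ count (triple_divisor (A, B, C) + {#Infty#}) P * f (chart R P t) = h t"
proof -
  have "\<not> mero_eq R f (\<lambda>_. 0)"
  proof
    assume "mero_eq R f (\<lambda>_. 0)"
    then have "\<forall>\<^sub>F t in at 0. t * f (chart R Infty t) = 0"
      unfolding mero_eq_def by (auto simp: curve_def elim: eventually_mono)
    then have "((\<lambda>t. t * f (chart R Infty t)) \<longlongrightarrow> 0) (at 0)"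
      by (rule tendsto_eventually)
    with f_asymp show False
      unfolding asymp_sqrt_iff using tendsto_unique[OF trivial_limit_at] zero_neq_one by blast
  qed
  then have "zorder (\<lambda>t. f (chart R P t)) 0 + int (count (triple_divisor (A, B, C) + {#Infty#}) P) \<ge> 0"
    "(\<lambda>t. f (chart R P t)) meromorphic_on {0}"
    using fL assms by (auto simp: L_space_def ord_at_def mero_curve_def)
  from meromorphic_removable[OF this(2,1)] that show thesis by blast
qed

lemma regular_outside:
  assumes "P \<in> affine_curve R" "P \<notin># triple_divisor (A, B, C)"
  obtains h where "h analytic_on {0}" "\<forall>\<^sub>F t in at 0. f (chart R P t) = h t"
proof -
  have "P \<in> curve R" "P \<noteq> Infty" using assms by (auto simp: affine_curve_def curve_def)
  moreover from this assms(2) have "count (triple_divisor (A, B, C) + {#Infty#}) P = 0"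
    by (simp add: not_in_iff)
  ultimately show thesis using pole_bound[of P] that by auto
qed

text \<open>The pole order at either point over \<open>a\<close> is at most the order of
  \<open>A\<close> there, so \<open>A\<close> absorbs it.\<close>

lemma times_A_ordinary:
  assumes "b \<noteq> 0" "b\<^sup>2 = poly R a"
  obtains h where "h analytic_on {0}" "\<forall>\<^sub>F t in at 0. poly A (a + t) * f (chart R (Aff a b) t) = h t"
proof -
  define n where "n = count (triple_divisor (A, B, C) + {#Infty#}) (Aff a b)"
  have "Aff a b \<in> curve R" using assms by (auto simp: curve_def affine_curve_def)
  from pole_bound[OF this] obtain h where h: "h analytic_on {0}"
    "\<forall>\<^sub>F t in at 0. t ^ n * f (chart R (Aff a b) t) = h t"
    unfolding n_def by blast
  have n: "n \<le> order a A"
    by (simp add: n_def count_triple_divisor[OF A_nz])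
  obtain q where q: "\<And>t. poly A (a + t) = t ^ order a A * poly q (a + t)"
    using order_factor[OF A_nz] by blast
  show thesis
  proof
    show "(\<lambda>t. t ^ (order a A - n) * poly q (a + t) * h t) analytic_on {0}"
      using h by (auto intro!: analytic_intros)
    have "t ^ order a A = t ^ (order a A - n) * t ^ n" for t :: complex
      using n by (simp add: power_add[symmetric])
    with h(2) show "\<forall>\<^sub>F t in at 0. poly A (a + t) * f (chart R (Aff a b) t) =
        t ^ (order a A - n) * poly q (a + t) * h t"
      by (auto elim!: eventually_mono simp: q mult_ac)
  qed
qed

text \<open>In the parameter \<open>t\<close> the polynomial \<open>A\<close> vanishes to twice its
  order at \<open>a\<close>: one half absorbs the pole, the other remains as the factor on the
  right.\<close>

lemma times_A_branch:
  assumes "poly R a = 0"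
  obtains h where "h analytic_on {0}"
    "\<forall>\<^sub>F t in at 0. poly A (a + t\<^sup>2) * f (chart R (Aff a 0) t) = t ^ order a A * h t"
proof -
  define n where "n = count (triple_divisor (A, B, C) + {#Infty#}) (Aff a 0)"
  have "Aff a 0 \<in> curve R" using assms by (auto simp: curve_def affine_curve_def)
  from pole_bound[OF this] obtain h where h: "h analytic_on {0}"
    "\<forall>\<^sub>F t in at 0. t ^ n * f (chart R (Aff a 0) t) = h t"
    unfolding n_def by blast
  have n: "n \<le> order a A"
    by (simp add: n_def count_triple_divisor[OF A_nz])
  obtain q where q: "\<And>t. poly A (a + t) = t ^ order a A * poly q (a + t)"
    using order_factor[OF A_nz] by blast
  show thesis
  proof
    show "(\<lambda>t. t ^ (order a A - n) * poly q (a + t\<^sup>2) * h t) analytic_on {0}"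
      using h by (auto intro!: analytic_intros)
    have "t ^ order a A = t ^ (order a A - n) * t ^ n" for t :: complex
      using n by (simp add: power_add[symmetric])
    then have *: "(t\<^sup>2) ^ order a A = t ^ order a A * (t ^ (order a A - n) * t ^ n)" for t :: complex
      by (metis power_even_eq power_mult power2_eq_square mult.commute)
    show "\<forall>\<^sub>F t in at 0. poly A (a + t\<^sup>2) * f (chart R (Aff a 0) t) =
        t ^ order a A * (t ^ (order a A - n) * poly q (a + t\<^sup>2) * h t)"
      using h(2)
    proof eventually_elim
      case (elim t)
      show ?case unfolding q * elim[symmetric] by (simp add: mult_ac)
    qed
  qed
qed

text \<open>The even and the odd part of \<open>A f\<close> under the hyperelliptic involution, the latter divided
  by \<open>y\<close>. Neither depends on the branch of the square root.\<close>

definition even_part :: "complex \<Rightarrow> complex" where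
  "even_part x = poly A x * (f (Aff x (csqrt (poly R x))) + f (Aff x (- csqrt (poly R x)))) / 2"

definition odd_part :: "complex \<Rightarrow> complex" where
  "odd_part x = poly A x * (f (Aff x (csqrt (poly R x))) - f (Aff x (- csqrt (poly R x)))) /
     (2 * csqrt (poly R x))"

lemma parts_eq:
  assumes "y\<^sup>2 = poly R x"
  shows "even_part x = poly A x * (f (Aff x y) + f (Aff x (- y))) / 2"
    "odd_part x = poly A x * (f (Aff x y) - f (Aff x (- y))) / (2 * y)"
proof -
  have "y\<^sup>2 = (csqrt (poly R x))\<^sup>2" using assms by simp
  then have "y = csqrt (poly R x) \<or> y = - csqrt (poly R x)" by (simp only: power2_eq_iff)
  then show "even_part x = poly A x * (f (Aff x y) + f (Aff x (- y))) / 2"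
    "odd_part x = poly A x * (f (Aff x y) - f (Aff x (- y))) / (2 * y)"
    unfolding even_part_def odd_part_def
    by (auto simp: add.commute minus_divide_right[symmetric] minus_divide_left algebra_simps)
qed

lemma times_A_eq_parts:
  assumes "y\<^sup>2 = poly R x" "y \<noteq> 0"
  shows "poly A x * f (Aff x y) = even_part x + y * odd_part x"
  unfolding parts_eq[OF assms(1)] using assms(2) by (simp add: field_simps)

lemma parts_ordinary:
  assumes "poly R a \<noteq> 0"
  shows "\<exists>h. h analytic_on {0} \<and> (\<forall>\<^sub>F t in at 0. even_part (a + t) = h t)"
    "\<exists>h. h analytic_on {0} \<and> (\<forall>\<^sub>F t in at 0. odd_part (a + t) = h t)"
proof -
  define b where "b = csqrt (poly R a)"
  have b: "b \<noteq> 0" "b\<^sup>2 = poly R a" using assms by (auto simp: b_def)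
  obtain Y where Y: "Y analytic_on {0}" "Y 0 = b" "\<And>t. (Y t)\<^sup>2 = poly R (a + t)"
    "\<And>t. chart R (Aff a b) t = Aff (a + t) (Y t)"
    "\<And>t. chart R (Aff a (- b)) t = Aff (a + t) (- Y t)"
    using chart_ordinary[OF b] by metis
  obtain h1 where h1: "h1 analytic_on {0}"
    "\<forall>\<^sub>F t in at 0. poly A (a + t) * f (Aff (a + t) (Y t)) = h1 t"
    by (rule times_A_ordinary[OF b, unfolded Y(4)])
  have nb: "- b \<noteq> 0" "(- b)\<^sup>2 = poly R a" using b by auto
  obtain h2 where h2: "h2 analytic_on {0}"
    "\<forall>\<^sub>F t in at 0. poly A (a + t) * f (Aff (a + t) (- Y t)) = h2 t"
    by (rule times_A_ordinary[OF nb, unfolded Y(5)])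
  have "(\<lambda>t. (h1 t + h2 t) / 2) analytic_on {0}" using h1 h2 by (auto intro!: analytic_intros)
  moreover have "\<forall>\<^sub>F t in at 0. even_part (a + t) = (h1 t + h2 t) / 2"
    using h1(2) h2(2) by eventually_elim (simp add: parts_eq(1)[OF Y(3)] distrib_left)
  ultimately show "\<exists>h. h analytic_on {0} \<and> (\<forall>\<^sub>F t in at 0. even_part (a + t) = h t)" by blast
  have "(\<lambda>t. (h1 t - h2 t) / (2 * Y t)) analytic_on {0}"
    using h1 h2 Y b by (auto intro!: analytic_intros)
  moreover have "\<forall>\<^sub>F t in at 0. odd_part (a + t) = (h1 t - h2 t) / (2 * Y t)"
    using h1(2) h2(2) by eventually_elim (simp add: parts_eq(2)[OF Y(3)] right_diff_distrib)
  ultimately show "\<exists>h. h analytic_on {0} \<and> (\<forall>\<^sub>F t in at 0. odd_part (a + t) = h t)" by blast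
qed

text \<open>Changing the sign of \<open>t\<close> exchanges the two sheets, so with \<open>h\<close>
  the germ of \<open>A f\<close> the even part is the mean of \<open>h t\<close> and
  \<open>h (- t)\<close>, and the odd part is the symmetric difference quotient divided by
  \<open>s\<close>.\<close>

lemma parts_branch:
  assumes "poly R a = 0"
  shows "\<exists>c. (even_part \<longlongrightarrow> c) (at a)" "\<exists>c. (odd_part \<longlongrightarrow> c) (at a)"
proof -
  obtain s where s: "s analytic_on {0}" "s 0 \<noteq> 0" "\<And>t. (t * s (t\<^sup>2))\<^sup>2 = poly R (a + t\<^sup>2)"
    "\<And>t. chart R (Aff a 0) t = Aff (a + t\<^sup>2) (t * s (t\<^sup>2))"
    using chart_branch[OF assms] by metis
  obtain h0 where h0: "h0 analytic_on {0}"
    "\<forall>\<^sub>F t in at 0. poly A (a + t\<^sup>2) * f (chart R (Aff a 0) t) = t ^ order a A * h0 t"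
    using times_A_branch[OF assms] by blast
  define h where "h = (\<lambda>t. t ^ order a A * h0 t)"
  have h: "h analytic_on {0}" using h0(1) unfolding h_def by (intro analytic_intros)
  have pos: "\<forall>\<^sub>F t in at 0. poly A (a + t\<^sup>2) * f (Aff (a + t\<^sup>2) (t * s (t\<^sup>2))) = h t"
    using h0(2) by (simp add: s(4) h_def)
  have neg: "\<forall>\<^sub>F t in at 0. poly A (a + t\<^sup>2) * f (Aff (a + t\<^sup>2) (- (t * s (t\<^sup>2)))) = h (- t)"
    using eventually_compose_filterlim[OF pos filterlim_uminus_at_0] by simp
  have hc: "(h \<longlongrightarrow> h 0) (at 0)" using analytic_at_imp_isCont[OF h] by (simp add: isCont_def)
  have hc': "((\<lambda>t. h (- t)) \<longlongrightarrow> h 0) (at 0)"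
    by (rule filterlim_compose[OF hc filterlim_uminus_at_0])
  have "((\<lambda>t. (h t + h (- t)) / 2) \<longlongrightarrow> (h 0 + h 0) / 2) (at 0)"
    by (intro tendsto_intros hc hc') simp
  moreover have "\<forall>\<^sub>F t in at 0. (h t + h (- t)) / 2 = even_part (a + t\<^sup>2)"
    using pos neg by eventually_elim (simp add: parts_eq(1)[OF s(3)] distrib_left)
  ultimately have "((\<lambda>t. even_part (a + t\<^sup>2)) \<longlongrightarrow> (h 0 + h 0) / 2) (at 0)"
    by (rule Lim_transform_eventually)
  from tendsto_at_square[OF this] show "\<exists>c. (even_part \<longlongrightarrow> c) (at a)" by blast
  have "((\<lambda>t. s (t\<^sup>2)) \<longlongrightarrow> s 0) (at 0)"
    by (rule tendsto_analytic_square[OF s(1)])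
  then have "((\<lambda>t. (h t - h (- t)) / (2 * t) / s (t\<^sup>2)) \<longlongrightarrow> deriv h 0 / s 0) (at 0)"
    by (intro tendsto_intros tendsto_odd_quotient h s(2))
  moreover have "\<forall>\<^sub>F t in at 0. (h t - h (- t)) / (2 * t) / s (t\<^sup>2) = odd_part (a + t\<^sup>2)"
    using pos neg by eventually_elim (simp add: parts_eq(2)[OF s(3)] right_diff_distrib mult.assoc)
  ultimately have "((\<lambda>t. odd_part (a + t\<^sup>2)) \<longlongrightarrow> deriv h 0 / s 0) (at 0)"
    by (rule Lim_transform_eventually)
  from tendsto_at_square[OF this] show "\<exists>c. (odd_part \<longlongrightarrow> c) (at a)" by blast
qed

text \<open>Put \<open>h t = t * f\<close>. After scaling by powers of \<open>t\<close>, the even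
  part is governed by the symmetric difference quotient of \<open>h\<close>, and the odd part by the
  mean of \<open>h t\<close> and \<open>h (- t)\<close>, which tends to \<open>h 0 = 1\<close> by
  the asymptotic of \<open>f\<close>.\<close>

lemma parts_infinity:
  shows "\<exists>c. ((\<lambda>x. even_part x / x ^ g) \<longlongrightarrow> c) at_infinity" "(odd_part \<longlongrightarrow> 1) at_infinity"
proof -
  obtain r where r: "r analytic_on {0}" "r 0 = 1"
    "\<And>t. t \<noteq> 0 \<Longrightarrow> (r (t\<^sup>2) / t ^ (2 * g + 1))\<^sup>2 = poly R (1 / t\<^sup>2)"
    "\<And>t. t \<noteq> 0 \<Longrightarrow> chart R Infty t = Aff (1 / t\<^sup>2) (r (t\<^sup>2) / t ^ (2 * g + 1))"
    using chart_infinity by metis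
  let ?y = "\<lambda>t. r (t\<^sup>2) / t ^ (2 * g + 1)"
  let ?A = "\<lambda>t. poly (reflect_poly A) (t\<^sup>2)"
  have "count (triple_divisor (A, B, C) + {#Infty#}) Infty = 1"
    using Infty_notin_triple_divisor by (simp add: not_in_iff)
  then obtain h where h: "h analytic_on {0}" "\<forall>\<^sub>F t in at 0. t * f (chart R Infty t) = h t"
    using pole_bound[of Infty] by (auto simp: curve_def)
  have hc: "(h \<longlongrightarrow> h 0) (at 0)" using analytic_at_imp_isCont[OF h(1)] by (simp add: isCont_def)
  then have "((\<lambda>t. t * f (chart R Infty t)) \<longlongrightarrow> h 0) (at 0)"
    using h(2) by (simp add: tendsto_cong)
  then have h01: "h 0 = 1"
    using f_asymp tendsto_unique[OF trivial_limit_at] unfolding asymp_sqrt_iff by blast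
  have hc': "((\<lambda>t. h (- t)) \<longlongrightarrow> h 0) (at 0)"
    by (rule filterlim_compose[OF hc filterlim_uminus_at_0])
  have nz: "\<forall>\<^sub>F t in at 0. t \<noteq> (0 :: complex)" by (simp add: eventually_at_filter)
  have pos: "\<forall>\<^sub>F t in at 0. f (Aff (1 / t\<^sup>2) (?y t)) = h t / t"
    using h(2) nz by eventually_elim (simp add: r(4) field_simps)
  \<comment> \<open>\<open>t ^ (2 * g + 1)\<close> is odd, so the conjugate point is the chart point
    at \<open>- t\<close>, where \<open>f\<close> equals \<open>h (- t) / (- t)\<close>.\<close>
  have neg: "\<forall>\<^sub>F t in at 0. f (Aff (1 / t\<^sup>2) (- ?y t)) = - (h (- t) / t)"
    using eventually_compose_filterlim[OF pos filterlim_uminus_at_0] by simp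
  have Ac: "(?A \<longlongrightarrow> 1) (at 0)"
  proof -
    have "(?A \<longlongrightarrow> poly (reflect_poly A) (0\<^sup>2)) (at 0)" by (intro tendsto_intros)
    then show ?thesis using monicA by simp
  qed
  have rc: "((\<lambda>t. r (t\<^sup>2)) \<longlongrightarrow> 1) (at 0)"
    using tendsto_analytic_square[OF r(1)] r(2) by simp
  have "((\<lambda>t. ?A t * ((h t - h (- t)) / (2 * t))) \<longlongrightarrow> 1 * deriv h 0) (at 0)"
    by (intro tendsto_intros Ac tendsto_odd_quotient h(1))
  moreover have "\<forall>\<^sub>F t in at 0. ?A t * ((h t - h (- t)) / (2 * t)) = even_part (1 / t\<^sup>2) / (1 / t\<^sup>2) ^ g"
    using pos neg nz
  proof eventually_elim
    case (elim t)
    have "even_part (1 / t\<^sup>2) = poly A (1 / t\<^sup>2) * (h t / t - h (- t) / t) / 2"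
      using elim by (simp add: parts_eq(1)[OF r(3)])
    then show ?case
      using elim(3) degA by (simp add: poly_inverse_square power_divide power_mult[symmetric] field_simps)
  qed
  ultimately have "((\<lambda>t. even_part (1 / t\<^sup>2) / (1 / t\<^sup>2) ^ g) \<longlongrightarrow> 1 * deriv h 0) (at 0)"
    by (rule Lim_transform_eventually)
  from tendsto_at_infinity_square[of "\<lambda>x. even_part x / x ^ g", OF this]
  show "\<exists>c. ((\<lambda>x. even_part x / x ^ g) \<longlongrightarrow> c) at_infinity" by blast
  have "((\<lambda>t. ?A t * ((h t + h (- t)) / 2) / r (t\<^sup>2)) \<longlongrightarrow> 1 * ((h 0 + h 0) / 2) / 1) (at 0)"
    by (intro tendsto_intros Ac hc hc' rc) auto
  moreover have "\<forall>\<^sub>F t in at 0. ?A t * ((h t + h (- t)) / 2) / r (t\<^sup>2) = odd_part (1 / t\<^sup>2)"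
    using pos neg nz
  proof eventually_elim
    case (elim t)
    have "odd_part (1 / t\<^sup>2) = poly A (1 / t\<^sup>2) * (h t / t + h (- t) / t) / (2 * ?y t)"
      using elim by (simp add: parts_eq(2)[OF r(3)])
    also have "\<dots> = (?A t / t ^ (2 * g)) * ((h t + h (- t)) / t) / (2 * ?y t)"
      using elim(3) degA by (simp add: poly_inverse_square add_divide_distrib)
    also have "\<dots> = ?A t * ((h t + h (- t)) / 2) / r (t\<^sup>2)"
      using elim(3) by (simp add: divide_simps)
    finally show ?case by simp
  qed
  ultimately have "((\<lambda>t. odd_part (1 / t\<^sup>2)) \<longlongrightarrow> 1 * ((h 0 + h 0) / 2) / 1) (at 0)"
    by (rule Lim_transform_eventually)
  from tendsto_at_infinity_square[OF this] show "(odd_part \<longlongrightarrow> 1) at_infinity"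
    using h01 by simp
qed

lemma finite_branch: "finite {a. poly R a = 0}"
  using degree_R by (intro poly_roots_finite) auto

text \<open>The entire extension has limit \<open>1\<close> at infinity, hence is constant by
  Liouville's theorem.\<close>

lemma odd_part_eq_1:
  assumes "poly R a \<noteq> 0"
  shows "\<forall>\<^sub>F x in at a. odd_part x = 1"
proof -
  obtain H where H: "H holomorphic_on UNIV" "\<And>a. (odd_part \<longlongrightarrow> H a) (at a)"
    "\<And>a. a \<notin> {a. poly R a = 0} \<Longrightarrow> \<forall>\<^sub>F x in at a. odd_part x = H x"
    using entire_extension[OF finite_branch, of "odd_part"]
      parts_ordinary(2) parts_branch(2) by blast
  have "(H \<longlongrightarrow> 1) at_infinity"
  proof (rule tendstoI)
    fix e :: real assume "e > 0"
    then have "\<forall>\<^sub>F x in at_infinity. dist (odd_part x) 1 < e / 2"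
      using parts_infinity(2) by (intro tendstoD) auto
    then obtain b where b: "\<And>x. norm x \<ge> b \<Longrightarrow> norm (odd_part x - 1) < e / 2"
      by (auto simp: eventually_at_infinity dist_norm)
    \<comment> \<open>The estimate is known for \<open>odd_part\<close>; it passes to
      \<open>H\<close>, a limit of \<open>odd_part\<close> at every point.\<close>
    have le: "norm (H x - 1) \<le> e / 2" if "b < norm x" for x
      by (rule norm_limit_le[of "{x. b < norm x}" _ "odd_part" _ "\<lambda>_. e / 2"])
         (use that b H(2) in \<open>auto simp: less_imp_le intro!: open_Collect_less continuous_intros\<close>)
    show "\<forall>\<^sub>F x in at_infinity. dist (H x) 1 < e"
      unfolding eventually_at_infinity dist_norm
      by (intro exI[of _ "b + 1"] allI impI le_less_trans[OF le]) (use \<open>e > 0\<close> in auto)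
  qed
  then have "H x = 1" for x using Liouville_weak[OF H(1)] by blast
  then show ?thesis using H(3)[of a] assms by simp
qed

text \<open>The entire extension grows at most like x^g, so it is its Taylor polynomial of degree at
  most \<open>g\<close> at \<open>0\<close>.\<close>

lemma even_part_eq_poly:
  obtains p where "degree p \<le> g"
    "\<And>a. poly R a \<noteq> 0 \<Longrightarrow> \<forall>\<^sub>F x in at a. even_part x = poly p x"
proof -
  obtain H where H: "H holomorphic_on UNIV" "\<And>a. (even_part \<longlongrightarrow> H a) (at a)"
    "\<And>a. a \<notin> {a. poly R a = 0} \<Longrightarrow> \<forall>\<^sub>F x in at a. even_part x = H x"
    using entire_extension[OF finite_branch, of "even_part"]
      parts_ordinary(1) parts_branch(1) by blast
  obtain c where "((\<lambda>x. even_part x / x ^ g) \<longlongrightarrow> c) at_infinity"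
    using parts_infinity(1) by blast
  then have "\<forall>\<^sub>F x in at_infinity. dist (even_part x / x ^ g) c < 1"
    by (rule tendstoD) simp
  then obtain b where b: "\<And>x. norm x \<ge> b \<Longrightarrow> norm (even_part x / x ^ g - c) < 1"
    by (auto simp: eventually_at_infinity dist_norm)
  \<comment> \<open>Beyond \<open>M\<close> the estimate holds and \<open>x\<close> is nonzero, so
    that one may multiply by x^g.\<close>
  define M where "M = max b 1"
  have bound: "norm (even_part x) \<le> (norm c + 1) * norm x ^ g" if "M < norm x" for x
  proof -
    have "x \<noteq> 0" "norm x \<ge> b" using that by (auto simp: M_def)
    have "norm (even_part x / x ^ g) \<le> norm c + 1"
      using b[OF \<open>norm x \<ge> b\<close>] norm_triangle_sub[of "even_part x / x ^ g" c] by linarith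
    then show ?thesis
      using \<open>x \<noteq> 0\<close> by (simp add: norm_divide norm_power divide_le_eq)
  qed
  have "norm (H x - 0) \<le> (norm c + 1) * norm x ^ g" if "M < norm x" for x
    by (rule norm_limit_le[of "{x. M < norm x}" _ even_part _ "\<lambda>x. (norm c + 1) * norm x ^ g"])
       (use that bound H(2) in \<open>auto intro!: open_Collect_less continuous_intros\<close>)
  then have H_bound: "norm (H x) \<le> (norm c + 1) * norm x ^ g" if "M + 1 \<le> norm x" for x
    using that by force
  have L: "H x = (\<Sum>k\<le>g. (deriv ^^ k) H 0 / fact k * x ^ k)" for x
    by (rule Liouville_polynomial[OF H(1), where A = "M + 1" and B = "norm c + 1"]) (rule H_bound)
  define p where "p = (\<Sum>k\<le>g. monom ((deriv ^^ k) H 0 / fact k) k)"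
  have "H x = poly p x" for x
    using L[of x] by (simp add: p_def poly_sum poly_monom)
  moreover have "degree p \<le> g"
    unfolding p_def by (intro degree_sum_le) (auto intro: order.trans[OF degree_monom_le])
  ultimately show thesis using H(3) that by auto
qed

text \<open>The even and odd parts give \<open>A f = p + y\<close>, so \<open>- p\<close> takes the
  place of \<open>B\<close>. The third entry \<open>C'\<close> is arbitrary, as \<open>phi\<close>
  does not depend on it.\<close>

lemma mero_eq_phi:
  obtains B' where "degree B' \<le> g" "mero_eq R f (phi (A, B', C'))"
proof -
  obtain p where p: "degree p \<le> g"
    "\<And>a. poly R a \<noteq> 0 \<Longrightarrow> \<forall>\<^sub>F x in at a. even_part x = poly p x"
    using even_part_eq_poly by blast
  have "mero_eq R f (phi (A, - p, C'))"
  proof (rule mero_eqI_ordinary)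
    show "mero_curve R f" using fL by (simp add: L_space_def)
    fix a assume a: "poly R a \<noteq> 0"
    have "R \<noteq> 0" using degree_R by auto
    from p(2)[OF a] odd_part_eq_1[OF a] eventually_poly_neq_0_at[OF A_nz, of a]
      eventually_poly_neq_0_at[OF \<open>R \<noteq> 0\<close>, of a]
    show "\<forall>\<^sub>F x in at a. \<forall>y. y\<^sup>2 = poly R x \<longrightarrow> f (Aff x y) = phi (A, - p, C') (Aff x y)"
    proof eventually_elim
      case (elim x)
      show ?case
      proof (intro allI impI)
        fix y assume y: "y\<^sup>2 = poly R x"
        then have "y \<noteq> 0" using elim by auto
        then show "f (Aff x y) = phi (A, - p, C') (Aff x y)"
          using times_A_eq_parts[OF y] elim by (simp add: field_simps)
      qed
    qed
  qed (rule mero_curve_phi)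
  then show thesis using p(1) that[of "- p"] by simp
qed

text \<open>The pole divisor of \<open>f\<close> determines \<open>B\<close> modulo \<open>A\<close>: over an ordinary root of \<open>A\<close> by
  regularity of \<open>f\<close> at the point conjugate to the pole.\<close>
lemma mero_eq_phi_shift:
  obtains \<beta> where "mero_eq R f (phi (A, B + smult \<beta> A, C'))"
proof -
  obtain B' where B': "degree B' \<le> g" "mero_eq R f (phi (A, B', C'))"
    using mero_eq_phi by blast
  have "A dvd B' - B"
  proof (rule dvd_if_order_le[OF A_nz])
    fix a assume a: "poly A a = 0"
    obtain q where q: "\<And>t. poly A (a + t) = t ^ order a A * poly q (a + t)"
      using order_factor[OF A_nz] by blast
    define b where "b = poly B a"
    have b: "b\<^sup>2 = poly R a" using discr_poly[of a] a by (simp add: b_def)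
    then have P: "Aff a b \<in> affine_curve R" "Aff a b \<in> curve R"
      by (auto simp: affine_curve_def curve_def)
    have f: "\<forall>\<^sub>F t in at 0. f (chart R (Aff a b) t) = phi (A, B', C') (chart R (Aff a b) t)"
      using B'(2) P(2) by (simp add: mero_eq_def)
    show "[:- a, 1:] ^ order a A dvd B' - B"
    proof (cases "b = 0")
      case False
      then have b': "b \<noteq> - poly B a" by (simp add: b_def eq_neg_iff_add_eq_0 flip: mult_2)
      then have "Aff a b \<notin># triple_divisor (A, B, C)"
        by (auto simp: triple_divisor_simp)
      \<comment> \<open>At the conjugate point \<open>(a, B(a))\<close> both \<open>f\<close> and
        the \<open>phi\<close> of the given triple are regular. Up to sign their difference is
        \<open>(B' - B) / A\<close>, so \<open>B' - B\<close> vanishes at \<open>a\<close> to the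
        order of \<open>A\<close>.\<close>
      from regular_outside[OF P(1) this] obtain h where h: "h analytic_on {0}"
        "\<forall>\<^sub>F t in at 0. f (chart R (Aff a b) t) = h t" by blast
      obtain h' where h': "h' analytic_on {0}"
        "\<forall>\<^sub>F t in at 0. phi (A, B, C) (chart R (Aff a b) t) = h' t"
        using phi_regular_ordinary[OF False b b'] by blast
      obtain Y where Y: "\<And>t. chart R (Aff a b) t = Aff (a + t) (Y t)"
        using chart_ordinary[OF False b] by metis
      have nz: "\<forall>\<^sub>F t in at 0. poly A (a + t) \<noteq> 0"
        by (rule eventually_compose_filterlim[OF eventually_poly_neq_0_at[OF A_nz] filterlim_plus_at])
      have "\<forall>\<^sub>F t in at 0. poly (B' - B) (a + t) = t ^ order a A * (poly q (a + t) * (h' t - h t))"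
        using f h(2) h'(2) nz
      proof eventually_elim
        case (elim t)
        then have eqs: "h t = (- poly B' (a + t) + Y t) / poly A (a + t)"
          "h' t = (- poly B (a + t) + Y t) / poly A (a + t)"
          by (simp_all add: Y)
        have "h' t - h t = poly (B' - B) (a + t) / poly A (a + t)"
          unfolding eqs by (simp add: diff_divide_distrib[symmetric])
        then show ?case using elim(4) by (simp add: q)
      qed
      moreover have "(\<lambda>t. poly q (a + t) * (h' t - h t)) analytic_on {0}"
        using h h' by (intro analytic_intros)
      ultimately show ?thesis
        by (intro power_dvd_if_quotient_cont) (auto dest: analytic_at_imp_isCont)
    next
      case True
      then have R0: "poly R a = 0" using b by simp
      \<comment> \<open>The root is simple, so it suffices that \<open>B'\<close> vanishes at
        \<open>a\<close>. Both \<open>y\<close> and \<open>A f\<close> tend to \<open>0\<close> like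
        a multiple of \<open>t\<close>, hence so does \<open>B' = y - A f\<close>.\<close>
      have ord: "order a A = 1"
        using order_at_branch_le_1[OF R0] a A_nz by (simp add: order_root)
      obtain s where s: "s analytic_on {0}"
        "\<And>t. chart R (Aff a 0) t = Aff (a + t\<^sup>2) (t * s (t\<^sup>2))"
        using chart_branch[OF R0] by metis
      obtain h where h: "h analytic_on {0}"
        "\<forall>\<^sub>F t in at 0. poly A (a + t\<^sup>2) * f (chart R (Aff a 0) t) = t ^ order a A * h t"
        using times_A_branch[OF R0] by blast
      have nz: "\<forall>\<^sub>F t in at 0. poly A (a + t\<^sup>2) \<noteq> 0"
        by (rule eventually_compose_filterlim[OF eventually_poly_neq_0_at[OF A_nz] filterlim_plus_square_at])
      have "\<forall>\<^sub>F t in at 0. t * s (t\<^sup>2) - t * h t = poly B' (a + t\<^sup>2)"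
        using f h(2) nz
      proof eventually_elim
        case (elim t)
        then show ?case by (simp add: True s(2) ord field_simps)
      qed
      moreover have "((\<lambda>t. t * s (t\<^sup>2) - t * h t) \<longlongrightarrow> 0 * s 0 - 0 * h 0) (at 0)"
        using analytic_at_imp_isCont[OF h(1)]
        by (intro tendsto_intros tendsto_analytic_square s(1)) (simp add: isCont_def)
      ultimately have "((\<lambda>t. poly B' (a + t\<^sup>2)) \<longlongrightarrow> 0) (at 0)"
        by (simp add: tendsto_cong)
      moreover have "((\<lambda>t. poly B' (a + t\<^sup>2)) \<longlongrightarrow> poly B' (a + 0\<^sup>2)) (at 0)"
        by (intro tendsto_intros)
      ultimately have "poly B' (a + 0\<^sup>2) = 0"
        using tendsto_unique[OF trivial_limit_at] by blast
      then have "poly (B' - B) a = 0" using True by (simp add: b_def)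
      then show ?thesis unfolding ord by (simp only: power_one_right poly_eq_0_iff_dvd)
    qed
  qed
  then obtain k where k: "B' - B = A * k" by (auto elim: dvdE)
  \<comment> \<open>\<open>B' - B\<close> has degree at most \<open>g\<close>, the degree of
    \<open>A\<close>, so the cofactor is a constant, namely the shift \<beta>.\<close>
  have "degree k = 0"
  proof (cases "k = 0")
    case False
    then have "degree (B' - B) = g + degree k"
      unfolding k using A_nz degA by (simp add: degree_mult_eq)
    moreover have "degree (B' - B) \<le> g" using B'(1) degB by (rule degree_diff_le)
    ultimately show ?thesis by simp
  qed simp
  then obtain \<beta> where "k = [:\<beta>:]" by (rule degree_eq_zeroE)
  then have "B' = B + smult \<beta> A" using k by (simp add: algebra_simps)
  then show thesis using B'(2) that by blast
qed

end

section \<open>Invariance under equality of meromorphic functions\<close>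

lemma mero_eq_chart: "mero_eq R f h \<Longrightarrow> P \<in> curve R \<Longrightarrow> \<forall>\<^sub>F t in at 0. f (chart R P t) = h (chart R P t)"
  by (simp add: mero_eq_def)

lemma L_space_if_pole_divisor:
  assumes "mero_eq R f h" "has_pole_divisor R h E"
  shows "f \<in> L_space R E"
proof -
  have "mero_curve R f"
    unfolding mero_curve_def
  proof
    fix P assume P: "P \<in> curve R"
    have "(\<lambda>t. h (chart R P t)) meromorphic_on {0}"
      using assms(2) P by (simp add: has_pole_divisor_def mero_curve_def)
    then show "(\<lambda>t. f (chart R P t)) meromorphic_on {0}"
      using meromorphic_on_cong[of "{0}" "\<lambda>t. f (chart R P t)" "\<lambda>t. h (chart R P t)" "{0}"]
        mero_eq_chart[OF assms(1) P] by simp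
  qed
  moreover have "ord_at R f P + int (count E P) \<ge> 0" if "P \<in> curve R" for P
  proof -
    have "ord_at R f P = ord_at R h P"
      unfolding ord_at_def by (rule zorder_cong[OF mero_eq_chart[OF assms(1) that] refl])
    then show ?thesis using assms(2) that by (simp add: has_pole_divisor_def)
  qed
  ultimately show ?thesis by (simp add: L_space_def)
qed

lemma asymp_sqrt_cong:
  assumes "mero_eq R f h"
  shows "asymp_sqrt R f \<longleftrightarrow> asymp_sqrt R h"
  unfolding asymp_sqrt_iff
  by (rule tendsto_cong, rule eventually_mono[OF mero_eq_chart[OF assms, of Infty]]) (simp_all add: curve_def)

lemma vanishes_at_cong:
  assumes "mero_eq R f h" "P \<in> affine_curve R"
  shows "vanishes_at R f P \<longleftrightarrow> vanishes_at R h P"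
  unfolding vanishes_at_def
  by (rule tendsto_cong, rule mero_eq_chart[OF assms(1)]) (use assms(2) in \<open>simp add: curve_def\<close>)

theorem theorem3:
  fixes g N :: nat and \<alpha> :: "nat \<Rightarrow> complex" and R :: "complex poly"
  assumes "N = 2 * g + 1"
    and "inj_on \<alpha> {1..N}"
    and "alpha_admissible g \<alpha> R"
    and "rsquarefree R"
  shows "\<exists>F :: triple \<Rightarrow> cpoint multiset \<times> complex.
    bij_betw F (triples_with_discr g \<alpha> R) (affine_jacobi g R \<times> UNIV) \<and>
    (\<forall>T \<in> triples_with_discr g \<alpha> R.
       has_pole_divisor R (phi T) (fst (F T) + {#Infty#}) \<and>
       ((\<lambda>t. phi T (chart R Infty t) - 1 / t) \<longlongrightarrow> snd (F T)) (at 0)) \<and>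
    (\<forall>D \<in> affine_jacobi g R. \<forall>f.
       f \<in> L_space R (D + {#Infty#}) \<and> asymp_sqrt R f \<longleftrightarrow>
       (\<exists>T \<in> triples_with_discr g \<alpha> R. fst (F T) = D \<and> mero_eq R f (phi T))) \<and>
    (poly R (\<alpha> N) \<noteq> 0 \<longrightarrow>
       (\<forall>D \<in> affine_jacobi g R.
          card {T \<in> pure_periodic_triples g \<alpha> R. fst (F T) = D} =
            (if \<exists>b. Aff (\<alpha> N) b \<in># D then 1 else 2)) \<and>
       (\<forall>D \<in> affine_jacobi g R. \<forall>f.
          f \<in> L_space R (D + {#Infty#}) \<and> asymp_sqrt R f \<and>
          (\<exists>b. Aff (\<alpha> N) b \<in> affine_curve R \<and> vanishes_at R f (Aff (\<alpha> N) b)) \<longleftrightarrow>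
          (\<exists>T \<in> pure_periodic_triples g \<alpha> R. fst (F T) = D \<and> mero_eq R f (phi T))))"
proof (intro exI[of _ "triple_coord g"] conjI ballI allI impI)
  note adm = assms(3,4)
  interpret odd_curve R g
    using alpha_admissible_monic[OF assms(3)] assms(4) by unfold_locales
  have ct: "curve_triple R g A B C" if "(A, B, C) \<in> triples_with_discr g \<alpha> R" for A B C
    using that triples_with_discr_iff[OF assms(3)] by unfold_locales auto
  have fst_coord: "fst (triple_coord g T) = triple_divisor T" for T
    by (cases T) (simp add: triple_coord_def)
  have pole: "has_pole_divisor R (phi T) (triple_divisor T + {#Infty#})"
    if "T \<in> triples_with_discr g \<alpha> R" for T
  proof -
    obtain A B C where T: "T = (A, B, C)" by (cases T)
    show ?thesis
      using that triple_divisor_in_affine_jacobi[OF adm that] unfolding T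
      by (rule curve_triple.has_pole_divisor_phi[OF ct])
  qed
  have char: "f \<in> L_space R (D + {#Infty#}) \<and> asymp_sqrt R f \<longleftrightarrow>
       (\<exists>T \<in> triples_with_discr g \<alpha> R. triple_divisor T = D \<and> mero_eq R f (phi T))"
    if D: "D \<in> affine_jacobi g R" for D f
  proof
    assume f: "f \<in> L_space R (D + {#Infty#}) \<and> asymp_sqrt R f"
    obtain A B C where T: "(A, B, C) \<in> triples_with_discr g \<alpha> R" "triple_divisor (A, B, C) = D"
      using triple_divisor_surj[OF assms(3) D] .
    have "\<exists>\<beta>. mero_eq R f (phi (A, B + smult \<beta> A, C'))" for C'
    proof -
      interpret curve_triple_function R g A B C f
        using ct[OF T(1)] f T(2) by (intro curve_triple_function.intro curve_triple_function_axioms.intro) auto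
      show ?thesis using mero_eq_phi_shift by blast
    qed
    \<comment> \<open>The third entry of the shifted triple depends on \<beta>, so \<beta> is first
      obtained with third entry \<open>0\<close>, which is then exchanged without altering
      \<open>phi\<close>.\<close>
    then obtain \<beta> where "mero_eq R f (phi (A, B + smult \<beta> A, 0))" by blast
    moreover have "phi (A, B', C') P = phi (A, B', 0) P" for B' C' P
      by (cases P) auto
    then have "phi (A, B', C') = phi (A, B', 0)" for B' C' by (rule ext)
    ultimately have "mero_eq R f (phi (A, B + smult \<beta> A, C + smult (2 * \<beta>) B + smult (\<beta>\<^sup>2) A))"
      by metis
    with triple_shift[OF assms(3) T(1), of \<beta>] T(2)
    show "\<exists>T \<in> triples_with_discr g \<alpha> R. triple_divisor T = D \<and> mero_eq R f (phi T)"
      by blast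
  next
    assume "\<exists>T \<in> triples_with_discr g \<alpha> R. triple_divisor T = D \<and> mero_eq R f (phi T)"
    then obtain T where T: "T \<in> triples_with_discr g \<alpha> R" "triple_divisor T = D" "mero_eq R f (phi T)"
      by blast
    have "asymp_sqrt R (phi T)"
      using T(1) by (cases T) (auto intro: curve_triple.asymp_sqrt_phi[OF ct])
    then show "f \<in> L_space R (D + {#Infty#}) \<and> asymp_sqrt R f"
      using L_space_if_pole_divisor[OF T(3) pole[OF T(1)]] T(2) asymp_sqrt_cong[OF T(3)] by simp
  qed
  show "bij_betw (triple_coord g) (triples_with_discr g \<alpha> R) (affine_jacobi g R \<times> UNIV)"
    by (rule bij_betw_triple_coord[OF adm])
  show "has_pole_divisor R (phi T) (fst (triple_coord g T) + {#Infty#})"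
    if "T \<in> triples_with_discr g \<alpha> R" for T
    using pole[OF that] by (simp add: fst_coord)
  show "((\<lambda>t. phi T (chart R Infty t) - 1 / t) \<longlongrightarrow> snd (triple_coord g T)) (at 0)"
    if "T \<in> triples_with_discr g \<alpha> R" for T
    using that by (cases T) (auto simp: triple_coord_def intro: curve_triple.phi_second_coeff[OF ct])
  show "f \<in> L_space R (D + {#Infty#}) \<and> asymp_sqrt R f \<longleftrightarrow>
       (\<exists>T \<in> triples_with_discr g \<alpha> R. fst (triple_coord g T) = D \<and> mero_eq R f (phi T))"
    if "D \<in> affine_jacobi g R" for D f
    unfolding fst_coord by (rule char[OF that])
  assume nz: "poly R (\<alpha> N) \<noteq> 0"
  show "card {T \<in> pure_periodic_triples g \<alpha> R. fst (triple_coord g T) = D} =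
            (if \<exists>b. Aff (\<alpha> N) b \<in># D then 1 else 2)" if "D \<in> affine_jacobi g R" for D
    using card_pure_periodic_triples[OF adm that] nz unfolding fst_coord assms(1) by simp
  \<comment> \<open>Vanishing depends on the germ alone, so it can be tested on
    \<open>phi T\<close>, where it means that the third entry vanishes at the distinguished
    point.\<close>
  have van: "(\<exists>b. Aff (\<alpha> N) b \<in> affine_curve R \<and> vanishes_at R f (Aff (\<alpha> N) b)) \<longleftrightarrow>
      T \<in> pure_periodic_triples g \<alpha> R"
    if T: "T \<in> triples_with_discr g \<alpha> R" "mero_eq R f (phi T)" for T f
  proof -
    obtain A B C where ABC: "T = (A, B, C)" by (cases T)
    have "(\<exists>b. Aff (\<alpha> N) b \<in> affine_curve R \<and> vanishes_at R f (Aff (\<alpha> N) b)) \<longleftrightarrow>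
        (\<exists>b. Aff (\<alpha> N) b \<in> affine_curve R \<and> vanishes_at R (phi T) (Aff (\<alpha> N) b))"
      using vanishes_at_cong[OF T(2)] by blast
    also have "\<dots> \<longleftrightarrow> poly C (\<alpha> N) = 0"
      unfolding ABC using T(1) by (intro curve_triple.phi_vanishes_over_iff[OF ct] nz) (auto simp: ABC)
    finally show ?thesis
      using T(1) by (simp add: ABC pure_periodic_triples_def assms(1))
  qed
  have pure: "T \<in> triples_with_discr g \<alpha> R" if "T \<in> pure_periodic_triples g \<alpha> R" for T
    using that by (auto simp: pure_periodic_triples_def)
  show "f \<in> L_space R (D + {#Infty#}) \<and> asymp_sqrt R f \<and>
          (\<exists>b. Aff (\<alpha> N) b \<in> affine_curve R \<and> vanishes_at R f (Aff (\<alpha> N) b)) \<longleftrightarrow>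
          (\<exists>T \<in> pure_periodic_triples g \<alpha> R. fst (triple_coord g T) = D \<and> mero_eq R f (phi T))"
    if "D \<in> affine_jacobi g R" for D f
    unfolding fst_coord using char[OF that] van pure by blast
qed

end
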